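(* Let $K$, $U$, $\Gamma$ be as in the context. (1) For every natural number $i$, the torsion theory $(\mathcal T_i,\mathcal F_i)$ in $\Gamma$-Mod is liftable to $U$-Mod. (2) Let $M$ be a simple $U$-module. There exists a unique natural number $i$ such that $t_i(M)=M$ and $t_{i-1}(M)=0$, and in that case all prime ideals in $\operatorname{Ass}(M)$ (where $M$ is regarded as a $\Gamma$-module) have coheight exactly $i$.
   Context: $K$ is an algebraically closed field of characteristic zero. $U$ is a $K$-algebra and $\Gamma\subseteq U$ a commutative $K$-subalgebra such that: (i) $\Gamma$ is finitely generated as a $K$-algebra; (ii) there are finitely many $u_1,\dots,u_n\in U$ such that $U$ is generated as a $K$-algebra by $\Gamma\cup\{u_1,\dots,u_n\}$; (iii) for every $u\in U$, the $\Gamma$-bimodule $\Gamma u\Gamma$ is finitely generated both as a left and as a right $\Gamma$-module. Define $Z_0=\operatorname{Specm}\Gamma$ and, for $i\ge1$, $Z_i=Z_{i-1}\cup\operatorname{Max}(\operatorname{Spec}\Gamma\setminus Z_{i-1})$ ($\operatorname{Max}$ = inclusion-maximal elements); the coheight of a prime $\mathbf p$ is the least $i$ with $\mathbf p\in Z_i$ (a natural number, as $\Gamma$ has finite Krull dimension). $\mathcal T_i$ is the class of $\Gamma$-modules $T$ with $\operatorname{Supp}(T)=\{\mathbf p:T_{\mathbf p}\neq0\}\subseteq Z_i$, $\mathcal F_i=\{F:\operatorname{Hom}_\Gamma(T,F)=0\ \forall T\in\mathcal T_i\}$, and $t_i(M)$ is the largest $\Gamma$-submodule of $M$ in $\mathcal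 T_i$; convention $t_{-1}(M)=0$. A torsion theory on $\Gamma$-Mod is liftable to $U$-Mod if for every $U$-module $M$ its torsion $\Gamma$-submodule is a $U$-submodule. $\operatorname{Ass}(M)$ is the set of primes of $\Gamma$ of the form $\operatorname{ann}_\Gamma(x)$, $x\in M$. *)

theory Defs
  imports "HOL-Computational_Algebra.Polynomial"
begin

definition is_K_algebra :: "('k::field \<Rightarrow> 'u::ring_1) \<Rightarrow> bool" where
  "is_K_algebra emb \<longleftrightarrow>
     emb 1 = 1 \<and> (\<forall>a b. emb (a + b) = emb a + emb b) \<and> (\<forall>a b. emb (a * b) = emb a * emb b)
     \<and> (\<forall>c u. emb c * u = u * emb c)"

definition is_subalg :: "('k::field \<Rightarrow> 'u::ring_1) \<Rightarrow> 'u set \<Rightarrow> bool" where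
  "is_subalg emb A \<longleftrightarrow> range emb \<subseteq> A \<and> (\<forall>x\<in>A. \<forall>y\<in>A. x + y \<in> A \<and> x * y \<in> A \<and> - x \<in> A)"

definition alg_gen :: "('k::field \<Rightarrow> 'u::ring_1) \<Rightarrow> 'u set \<Rightarrow> 'u set" where
  "alg_gen emb S = \<Inter> {A. is_subalg emb A \<and> S \<subseteq> A}"

definition bimod :: "'u::ring_1 set \<Rightarrow> 'u \<Rightarrow> 'u set" where
  "bimod G u = {x. \<exists>(n::nat) a b. (\<forall>j<n. a j \<in> G \<and> b j \<in> G) \<and> x = (\<Sum>j<n. a j * u * b j)}"

definition left_fg :: "'u::ring_1 set \<Rightarrow> 'u set \<Rightarrow> bool" where
  "left_fg G B \<longleftrightarrow> (\<exists>F. finite F \<and> F \<subseteq> B \<and>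
      B = {x. \<exists>c. (\<forall>f\<in>F. c f \<in> G) \<and> x = (\<Sum>f\<in>F. c f * f)})"

definition right_fg :: "'u::ring_1 set \<Rightarrow> 'u set \<Rightarrow> bool" where
  "right_fg G B \<longleftrightarrow> (\<exists>F. finite F \<and> F \<subseteq> B \<and>
      B = {x. \<exists>c. (\<forall>f\<in>F. c f \<in> G) \<and> x = (\<Sum>f\<in>F. f * c f)})"

definition standing_hyps :: "('k::field \<Rightarrow> 'u::ring_1) \<Rightarrow> 'u set \<Rightarrow> bool" where
  "standing_hyps emb G \<longleftrightarrow>
     is_K_algebra emb \<and> is_subalg emb G \<and> (\<forall>a\<in>G. \<forall>b\<in>G. a * b = b * a)
     \<and> (\<exists>S. finite S \<and> S \<subseteq> G \<and> alg_gen emb S = G)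
     \<and> (\<exists>F. finite F \<and> alg_gen emb (G \<union> F) = UNIV)
     \<and> (\<forall>u. left_fg G (bimod G u) \<and> right_fg G (bimod G u))"

definition g_ideal :: "'u::ring_1 set \<Rightarrow> 'u set \<Rightarrow> bool" where
  "g_ideal G P \<longleftrightarrow> P \<subseteq> G \<and> 0 \<in> P \<and> (\<forall>x\<in>P. \<forall>y\<in>P. x + y \<in> P) \<and> (\<forall>x\<in>P. - x \<in> P)
     \<and> (\<forall>a\<in>G. \<forall>x\<in>P. a * x \<in> P)"

definition g_prime :: "'u::ring_1 set \<Rightarrow> 'u set \<Rightarrow> bool" where
  "g_prime G P \<longleftrightarrow> g_ideal G P \<and> P \<noteq> G \<and> (\<forall>a\<in>G. \<forall>b\<in>G. a * b \<in> P \<longrightarrow> a \<in> P \<or> b \<in> P)"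

definition g_maximal :: "'u::ring_1 set \<Rightarrow> 'u set \<Rightarrow> bool" where
  "g_maximal G P \<longleftrightarrow> g_ideal G P \<and> P \<noteq> G \<and>
     (\<forall>Q. g_ideal G Q \<and> P \<subseteq> Q \<longrightarrow> Q = P \<or> Q = G)"

definition Spec :: "'u::ring_1 set \<Rightarrow> 'u set set" where
  "Spec G = {P. g_prime G P}"

definition Specm :: "'u::ring_1 set \<Rightarrow> 'u set set" where
  "Specm G = {P. g_maximal G P}"

definition MaxEl :: "'a set set \<Rightarrow> 'a set set" where
  "MaxEl S = {P \<in> S. \<forall>Q\<in>S. P \<subseteq> Q \<longrightarrow> Q = P}"

primrec Zc :: "'u::ring_1 set \<Rightarrow> nat \<Rightarrow> 'u set set" where
  "Zc G 0 = Specm G"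
| "Zc G (Suc i) = Zc G i \<union> MaxEl (Spec G - Zc G i)"

definition coheight :: "'u::ring_1 set \<Rightarrow> 'u set \<Rightarrow> nat" where
  "coheight G P = (LEAST i. P \<in> Zc G i)"

definition U_module :: "('u::ring_1 \<Rightarrow> 'm::ab_group_add \<Rightarrow> 'm) \<Rightarrow> bool" where
  "U_module act \<longleftrightarrow>
     (\<forall>a b x. act (a + b) x = act a x + act b x) \<and> (\<forall>a x y. act a (x + y) = act a x + act a y)
     \<and> (\<forall>a b x. act (a * b) x = act a (act b x)) \<and> (\<forall>x. act 1 x = x)"

definition U_submodule :: "('u::ring_1 \<Rightarrow> 'm::ab_group_add \<Rightarrow> 'm) \<Rightarrow> 'm set \<Rightarrow> bool" where
  "U_submodule act N \<longleftrightarrow> 0 \<in> N \<and> (\<forall>x\<in>N. \<forall>y\<in>N. x + y \<in> N) \<and> (\<forall>a. \<forall>x\<in>N. act a x \<in> N)"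

definition simple_U_module :: "('u::ring_1 \<Rightarrow> 'm::ab_group_add \<Rightarrow> 'm) \<Rightarrow> bool" where
  "simple_U_module act \<longleftrightarrow> U_module act \<and> (UNIV :: 'm set) \<noteq> {0} \<and>
     (\<forall>N. U_submodule act N \<longrightarrow> N = {0} \<or> N = UNIV)"

definition G_submodule :: "'u::ring_1 set \<Rightarrow> ('u \<Rightarrow> 'm::ab_group_add \<Rightarrow> 'm) \<Rightarrow> 'm set \<Rightarrow> bool" where
  "G_submodule G act N \<longleftrightarrow> 0 \<in> N \<and> (\<forall>x\<in>N. \<forall>y\<in>N. x + y \<in> N) \<and> (\<forall>a\<in>G. \<forall>x\<in>N. act a x \<in> N)"

text \<open>Support of a Gamma-module N: primes p with N_p \<noteq> 0. Unfolding the localization,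
  N_p \<noteq> 0 iff some x/1 \<noteq> 0 in N_p, i.e. iff some x \<in> N is not killed by any s \<in> Gamma - p.\<close>
definition Supp :: "'u::ring_1 set \<Rightarrow> ('u \<Rightarrow> 'm::ab_group_add \<Rightarrow> 'm) \<Rightarrow> 'm set \<Rightarrow> 'u set set" where
  "Supp G act N = {P \<in> Spec G. \<exists>x\<in>N. \<forall>s\<in>G - P. act s x \<noteq> 0}"

definition in_T :: "'u::ring_1 set \<Rightarrow> ('u \<Rightarrow> 'm::ab_group_add \<Rightarrow> 'm) \<Rightarrow> nat \<Rightarrow> 'm set \<Rightarrow> bool" where
  "in_T G act i N \<longleftrightarrow> Supp G act N \<subseteq> Zc G i"

definition tors :: "'u::ring_1 set \<Rightarrow> ('u \<Rightarrow> 'm::ab_group_add \<Rightarrow> 'm) \<Rightarrow> nat \<Rightarrow> 'm set" where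
  "tors G act i = (THE N. G_submodule G act N \<and> in_T G act i N \<and>
        (\<forall>N'. G_submodule G act N' \<and> in_T G act i N' \<longrightarrow> N' \<subseteq> N))"

definition Ass :: "'u::ring_1 set \<Rightarrow> ('u \<Rightarrow> 'm::ab_group_add \<Rightarrow> 'm) \<Rightarrow> 'u set set" where
  "Ass G act = {P \<in> Spec G. \<exists>x. P = {a \<in> G. act a x = 0}}"

end

theory Submission
  imports Defs
begin

text \<open>For a module element \<open>x\<close>, the support of \<open>\<Gamma>x\<close> consists of the primes above the annihilator of
  \<open>x\<close>, and \<open>Z\<^sub>i\<close> consists of the primes above which all chains have length at most \<open>i\<close>. Let \<open>E\<close> be
  the commutative ring generated by the left and right multiplications by \<open>\<Gamma>\<close> on \<open>U\<close>. Evaluation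
  at \<open>u\<close> identifies \<open>E\<close> modulo the annihilator of \<open>u\<close> with \<open>\<Gamma>u\<Gamma>\<close>, so \<open>E\<close> is finite over both copies of
  \<open>\<Gamma>\<close> modulo that annihilator. A chain of primes above the annihilator of \<open>ux\<close> therefore lifts by
  going up along the left multiplications to a chain in \<open>E\<close>, which contracts along the right
  multiplications, strictly by incomparability, to a chain above the annihilator of \<open>x\<close>. Hence
  the torsion part is a \<open>U\<close>-submodule. Going up needs only Nakayama's lemma and incomparability only
  a linear dependence between powers, so no Noetherian or determinant arguments enter.

  For a simple module the torsion parts form an increasing sequence of submodules, each zero or
  everything; it reaches everything because \<open>\<Gamma>\<close> has finite Krull dimension.\<close>

section \<open>Ideals of commutative subrings\<close>

locale comm_subring =
  fixes R :: "'a::ring_1 set"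
  assumes one_mem [simp]: "1 \<in> R"
    and add_mem [simp]: "\<And>x y. x \<in> R \<Longrightarrow> y \<in> R \<Longrightarrow> x + y \<in> R"
    and mult_mem [simp]: "\<And>x y. x \<in> R \<Longrightarrow> y \<in> R \<Longrightarrow> x * y \<in> R"
    and minus_mem [simp]: "\<And>x. x \<in> R \<Longrightarrow> - x \<in> R"
    and comm: "\<And>x y. x \<in> R \<Longrightarrow> y \<in> R \<Longrightarrow> x * y = y * x"
begin

lemma zero_mem [simp]: "0 \<in> R"
  using add_mem[OF one_mem minus_mem[OF one_mem]] by simp

lemma diff_mem [simp]: "x \<in> R \<Longrightarrow> y \<in> R \<Longrightarrow> x - y \<in> R"
  using add_mem[of x "- y"] by simp

lemma sum_mem: "(\<And>i. i \<in> I \<Longrightarrow> f i \<in> R) \<Longrightarrow> sum f I \<in> R"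
  by (induction I rule: infinite_finite_induct) auto

lemma power_mem [simp]: "x \<in> R \<Longrightarrow> x ^ n \<in> R"
  by (induction n) auto

lemma
  assumes "g_ideal R P"
  shows ideal_subset: "P \<subseteq> R"
    and ideal_zero: "0 \<in> P"
    and ideal_add: "x \<in> P \<Longrightarrow> y \<in> P \<Longrightarrow> x + y \<in> P"
    and ideal_minus: "x \<in> P \<Longrightarrow> - x \<in> P"
    and ideal_mult_left: "a \<in> R \<Longrightarrow> x \<in> P \<Longrightarrow> a * x \<in> P"
  using assms by (auto simp: g_ideal_def)

lemma idealI:
  assumes "P \<subseteq> R" "0 \<in> P" "\<And>x y. x \<in> P \<Longrightarrow> y \<in> P \<Longrightarrow> x + y \<in> P"
    "\<And>a x. a \<in> R \<Longrightarrow> x \<in> P \<Longrightarrow> a * x \<in> P"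
  shows "g_ideal R P"
proof -
  have "- x \<in> P" if "x \<in> P" for x using assms(4)[of "- 1" x] that by simp
  then show ?thesis using assms unfolding g_ideal_def by blast
qed

lemma ideal_mult_right: "g_ideal R P \<Longrightarrow> a \<in> R \<Longrightarrow> x \<in> P \<Longrightarrow> x * a \<in> P"
  by (metis comm ideal_mult_left ideal_subset subsetD)

lemma ideal_diff: "g_ideal R P \<Longrightarrow> x \<in> P \<Longrightarrow> y \<in> P \<Longrightarrow> x - y \<in> P"
  using ideal_add[of P x "- y"] ideal_minus[of P y] by simp

lemma ideal_sum: "g_ideal R P \<Longrightarrow> (\<And>i. i \<in> I \<Longrightarrow> f i \<in> P) \<Longrightarrow> sum f I \<in> P"
  by (induction I rule: infinite_finite_induct) (auto simp: ideal_zero ideal_add)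

lemma prime_ideal: "g_prime R P \<Longrightarrow> g_ideal R P"
  by (simp add: g_prime_def)

lemma one_notin_ideal: "g_ideal R P \<Longrightarrow> P \<noteq> R \<Longrightarrow> 1 \<notin> P"
  using ideal_mult_left[of P _ 1] ideal_subset by fastforce

lemma prime_one: "g_prime R P \<Longrightarrow> 1 \<notin> P"
  by (simp add: g_prime_def one_notin_ideal)

lemma prime_mult: "g_prime R P \<Longrightarrow> a \<in> R \<Longrightarrow> b \<in> R \<Longrightarrow> a * b \<in> P \<Longrightarrow> a \<in> P \<or> b \<in> P"
  by (simp add: g_prime_def)

text \<open>Zorn's lemma gives an ideal maximal among those containing \<open>N\<close> and disjoint
  from the multiplicative set \<open>S\<close>; maximality forces primality. It is also exported,
  since \<open>going_up\<close> applies it to an enlarged ideal.\<close>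

lemma exists_prime_avoiding:
  assumes N: "g_ideal R N" and S: "1 \<in> S" "\<And>x y. x \<in> S \<Longrightarrow> y \<in> S \<Longrightarrow> x * y \<in> S"
    and NS: "N \<inter> S = {}"
  obtains Q where "g_prime R Q" "N \<subseteq> Q" "Q \<inter> S = {}"
    "\<And>Q'. g_ideal R Q' \<Longrightarrow> Q \<subseteq> Q' \<Longrightarrow> Q' \<inter> S = {} \<Longrightarrow> Q' = Q"
proof -
  define \<A> where "\<A> = {Q. g_ideal R Q \<and> N \<subseteq> Q \<and> Q \<inter> S = {}}"
  have "\<exists>M\<in>\<A>. \<forall>X\<in>\<A>. M \<subseteq> X \<longrightarrow> X = M"
  proof (rule subset_Zorn_nonempty)
    show "\<A> \<noteq> {}" using N NS by (auto simp: \<A>_def)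
    fix C assume C: "C \<noteq> {}" "subset.chain \<A> C"
    then have sub: "C \<subseteq> \<A>" and ch: "\<And>X Y. X \<in> C \<Longrightarrow> Y \<in> C \<Longrightarrow> X \<subseteq> Y \<or> Y \<subseteq> X"
      by (auto simp: subset_chain_def)
    have id: "g_ideal R X" if "X \<in> C" for X using sub that by (auto simp: \<A>_def)
    have "x + y \<in> \<Union>C" if xy: "x \<in> \<Union>C" "y \<in> \<Union>C" for x y
    proof -
      obtain X Y where "X \<in> C" "Y \<in> C" "x \<in> X" "y \<in> Y" using xy by blast
      then show ?thesis using ch[of X Y] id ideal_add by blast
    qed
    moreover have "0 \<in> \<Union>C" using C(1) id ideal_zero by blast
    moreover have "\<Union>C \<subseteq> R" using id ideal_subset by blast
    moreover have "\<forall>x\<in>\<Union>C. - x \<in> \<Union>C" using id ideal_minus by blast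
    moreover have "\<forall>a\<in>R. \<forall>x\<in>\<Union>C. a * x \<in> \<Union>C" using id ideal_mult_left by blast
    ultimately have "g_ideal R (\<Union>C)"
      unfolding g_ideal_def by blast
    then show "\<Union>C \<in> \<A>" using sub C(1) by (auto simp: \<A>_def)
  qed
  then obtain Q where Q: "Q \<in> \<A>" and mx: "\<And>X. X \<in> \<A> \<Longrightarrow> Q \<subseteq> X \<Longrightarrow> X = Q" by auto
  have iQ: "g_ideal R Q" and NQ: "N \<subseteq> Q" and QS: "Q \<inter> S = {}" using Q by (auto simp: \<A>_def)
  \<comment> \<open>\<open>?X\<close> is the ideal generated by \<open>Q\<close> and
    \<open>a\<close>. It is strictly larger than \<open>Q\<close>, so by maximality it meets
    \<open>S\<close>.\<close>
  have meets: "\<exists>q\<in>Q. \<exists>c\<in>R. q + c * a \<in> S" if a: "a \<in> R" "a \<notin> Q" for a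
  proof -
    let ?X = "{q + c * a |q c. q \<in> Q \<and> c \<in> R}"
    have add: "x + y \<in> ?X" if xy: "x \<in> ?X" "y \<in> ?X" for x y
    proof -
      obtain q c q' c' where "x = q + c * a" "y = q' + c' * a" "q \<in> Q" "c \<in> R" "q' \<in> Q" "c' \<in> R"
        using xy by blast
      then have "x + y = (q + q') + (c + c') * a" "q + q' \<in> Q" "c + c' \<in> R"
        using iQ by (auto simp: algebra_simps ideal_add)
      then show ?thesis by blast
    qed
    have mul: "r * x \<in> ?X" if xy: "x \<in> ?X" and r: "r \<in> R" for x r
    proof -
      obtain q c where "x = q + c * a" "q \<in> Q" "c \<in> R" using xy by blast
      then have "r * x = (r * q) + (r * c) * a" "r * q \<in> Q" "r * c \<in> R"
        using iQ r by (auto simp: algebra_simps ideal_mult_left)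
      then show ?thesis by blast
    qed
    have sub: "Q \<subseteq> ?X"
    proof
      fix q assume "q \<in> Q"
      then show "q \<in> ?X" by (intro CollectI exI[of _ q] exI[of _ 0]) auto
    qed
    have "?X \<subseteq> R" using iQ ideal_subset a by fastforce
    then have iX: "g_ideal R ?X"
      by (rule idealI) (fact subsetD[OF sub ideal_zero[OF iQ]] add mul[rotated])+
    have "a \<in> ?X"
      by (intro CollectI exI[of _ 0] exI[of _ 1]) (auto simp: ideal_zero iQ)
    then have "?X \<noteq> Q" using a by auto
    then have "?X \<notin> \<A>" using mx sub by blast
    then have "?X \<inter> S \<noteq> {}" using iX NQ sub by (simp add: \<A>_def)
    then show ?thesis by blast
  qed
  have "g_prime R Q"
  proof -
    have "a \<in> Q \<or> b \<in> Q" if ab: "a \<in> R" "b \<in> R" "a * b \<in> Q" for a b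
    proof (rule ccontr)
      assume "\<not> ?thesis"
      then obtain q c q' c' where q: "q \<in> Q" "c \<in> R" "q + c * a \<in> S"
        and q': "q' \<in> Q" "c' \<in> R" "q' + c' * b \<in> S"
        using meets ab by meson
      \<comment> \<open>The product lies in \<open>S\<close>, but each term of its expansion lies in
        \<open>Q\<close> once \<open>a * b\<close> does.\<close>
      have "(q + c * a) * (q' + c' * b) = q * (q' + c' * b) + (c * a) * q' + c * (a * c') * b"
        by (simp add: algebra_simps)
      also have "a * c' = c' * a" using comm ab q' by simp
      finally have "(q + c * a) * (q' + c' * b) = q * (q' + c' * b) + (c * a) * q' + (c * c') * (a * b)"
        by (simp add: algebra_simps)
      moreover have "q' \<in> R" using q' iQ ideal_subset by auto
      ultimately have "(q + c * a) * (q' + c' * b) \<in> Q"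
        using q q' ab by (simp add: ideal_add[OF iQ] ideal_mult_left[OF iQ] ideal_mult_right[OF iQ])
      then show False using S(2)[OF q(3) q'(3)] QS by auto
    qed
    moreover have "Q \<noteq> R" using S(1) QS by auto
    ultimately show ?thesis using iQ by (auto simp: g_prime_def)
  qed
  moreover have "Q' = Q" if "g_ideal R Q'" "Q \<subseteq> Q'" "Q' \<inter> S = {}" for Q'
    using mx[of Q'] that NQ by (auto simp: \<A>_def)
  ultimately show ?thesis using that NQ QS by blast
qed

text \<open>Any proper ideal lies below a prime avoiding \<open>{1}\<close>, so maximality can be
  tested against primes. This gives \<open>Zc R 0\<close> the same shape as the higher
  layers.\<close>

lemma maximal_iff: "g_maximal R P \<longleftrightarrow> g_prime R P \<and> (\<forall>Q. g_prime R Q \<and> P \<subseteq> Q \<longrightarrow> Q = P)"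
proof -
  have over: "\<exists>Q. g_prime R Q \<and> N \<subseteq> Q" if N: "g_ideal R N" "N \<noteq> R" for N
    by (rule exists_prime_avoiding[OF N(1), of "{1}"]) (use one_notin_ideal[OF N] in auto)
  show ?thesis
  proof
    assume mx: "g_maximal R P"
    then have "g_ideal R P" "P \<noteq> R" by (auto simp: g_maximal_def)
    then obtain Q where "g_prime R Q" "P \<subseteq> Q" using over by blast
    moreover have eq: "Q' = P" if "g_prime R Q'" "P \<subseteq> Q'" for Q'
      using mx that by (auto simp: g_maximal_def g_prime_def)
    ultimately show "g_prime R P \<and> (\<forall>Q. g_prime R Q \<and> P \<subseteq> Q \<longrightarrow> Q = P)" by blast
  next
    assume P: "g_prime R P \<and> (\<forall>Q. g_prime R Q \<and> P \<subseteq> Q \<longrightarrow> Q = P)"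
    have "Q = P \<or> Q = R" if "g_ideal R Q" "P \<subseteq> Q" for Q
      using over[OF that(1)] that(2) P by blast
    then show "g_maximal R P" using P by (auto simp: g_maximal_def g_prime_def)
  qed
qed

section \<open>The layers Z_i described by strict inclusions of primes\<close>

lemma Zc_0_iff: "P \<in> Zc R 0 \<longleftrightarrow> g_prime R P \<and> (\<forall>Q. g_prime R Q \<longrightarrow> \<not> P \<subset> Q)"
  by (auto simp: Specm_def maximal_iff)

lemma Zc_subset_Spec: "Zc R i \<subseteq> Spec R"
  by (induction i) (auto simp: Specm_def Spec_def maximal_iff MaxEl_def)

text \<open>Each stage adds only maximal elements of the complement, so the primes strictly above a
  new one were present before.\<close>

lemma Zc_upward: "P \<in> Zc R i \<Longrightarrow> g_prime R Q \<Longrightarrow> P \<subseteq> Q \<Longrightarrow> Q \<in> Zc R i"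
proof (induction i)
  case 0
  then show ?case by (auto simp: Specm_def maximal_iff)
next
  case (Suc i)
  have "Q = P \<or> Q \<in> Zc R i" if "P \<in> MaxEl (Spec R - Zc R i)"
    using that Suc.prems by (auto simp: MaxEl_def Spec_def)
  then show ?case using Suc by auto
qed

text \<open>If all primes strictly above \<open>P\<close> are in \<open>Zc R i\<close>, then
  \<open>P\<close> is there too or is maximal in the complement. In this form chains of primes can
  be compared one link at a time.\<close>

lemma Zc_Suc_iff: "P \<in> Zc R (Suc i) \<longleftrightarrow> g_prime R P \<and> (\<forall>Q. g_prime R Q \<and> P \<subset> Q \<longrightarrow> Q \<in> Zc R i)"
  using Zc_upward[of P i] Zc_subset_Spec[of i] by (auto simp: MaxEl_def Spec_def psubset_eq)

lemma Zc_mono: "i \<le> j \<Longrightarrow> Zc R i \<subseteq> Zc R j"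
  by (rule lift_Suc_mono_le[of "Zc R"]) auto

end

section \<open>Linear systems modulo a prime\<close>

text \<open>Fraction-free Gaussian elimination.\<close>

lemma (in comm_subring) linear_system_nontrivial_solution:
  assumes P: "g_prime R P" and "finite F" "finite I" "card F < card I"
    and "\<And>i f. i \<in> I \<Longrightarrow> f \<in> F \<Longrightarrow> g i f \<in> R"
  shows "\<exists>a. (\<forall>i\<in>I. a i \<in> R) \<and> (\<exists>i\<in>I. a i \<notin> P) \<and> (\<forall>f\<in>F. (\<Sum>i\<in>I. a i * g i f) \<in> P)"
  using assms(2-)
proof (induction F arbitrary: I g rule: finite_induct)
  case empty
  then show ?case using prime_one[OF P]
    by (intro exI[of _ "\<lambda>_. 1"]) (auto simp: card_gt_0_iff)
next
  case (insert f F)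
  note g = insert.prems(3)
  have iP: "g_ideal R P" using P by (rule prime_ideal)
  show ?case
  proof (cases "\<forall>i\<in>I. g i f \<in> P")
    case True
    \<comment> \<open>Equation \<open>f\<close> holds modulo \<open>P\<close> for any coefficients,
      so a solution of the remaining equations suffices.\<close>
    obtain a where "\<forall>i\<in>I. a i \<in> R" "\<exists>i\<in>I. a i \<notin> P" "\<forall>f\<in>F. (\<Sum>i\<in>I. a i * g i f) \<in> P"
      using insert.IH[of I g] insert.prems insert.hyps by auto
    then show ?thesis using True iP
      by (intro exI[of _ a]) (auto intro!: ideal_sum ideal_mult_left)
  next
    case False
    then obtain i0 where i0: "i0 \<in> I" "g i0 f \<notin> P" by auto
    define h where "h = g i0 f"
    have h: "h \<in> R" "h \<notin> P" using i0 g by (auto simp: h_def)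
    define I' where "I' = I - {i0}"
    have I: "I = insert i0 I'" "i0 \<notin> I'" "finite I'" using i0 insert.prems by (auto simp: I'_def)
    have g': "g i f' \<in> R" if "i \<in> I'" "f' \<in> insert f F" for i f' using g that I by auto
    \<comment> \<open>Cross multiplication with the pivot \<open>h\<close> clears the column of
      \<open>f\<close> without division.\<close>
    define g2 where "g2 i f' = h * g i f' - g i f * g i0 f'" for i f'
    have "card F < card I'" using insert.prems insert.hyps I by auto
    moreover have "g2 i f' \<in> R" if "i \<in> I'" "f' \<in> F" for i f'
      using g' g that h i0 by (simp add: g2_def)
    ultimately obtain a where a: "\<forall>i\<in>I'. a i \<in> R" "\<exists>i\<in>I'. a i \<notin> P"
        "\<forall>f\<in>F. (\<Sum>i\<in>I'. a i * g2 i f) \<in> P"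
      using insert.IH[of I' g2] I by auto
    \<comment> \<open>Back substitution: after scaling the reduced solution by \<open>h\<close>, the
      coefficient at \<open>i0\<close> cancels equation \<open>f\<close> exactly.\<close>
    define b where "b i = (if i = i0 then - (\<Sum>i\<in>I'. a i * g i f) else a i * h)" for i
    have bI': "b i = a i * h" if "i \<in> I'" for i using that I by (auto simp: b_def)
    have split: "(\<Sum>i\<in>I. b i * g i f') = (\<Sum>i\<in>I'. a i * h * g i f' - a i * g i f * g i0 f')" for f'
    proof -
      have "(\<Sum>i\<in>I. b i * g i f') = b i0 * g i0 f' + (\<Sum>i\<in>I'. b i * g i f')" using I by simp
      also have "(\<Sum>i\<in>I'. b i * g i f') = (\<Sum>i\<in>I'. a i * h * g i f')"
        using bI' by (intro sum.cong) auto
      finally show ?thesis by (simp add: b_def sum_subtractf sum_distrib_right)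
    qed
    show ?thesis
    proof (intro exI[of _ b] conjI ballI)
      show "b i \<in> R" if "i \<in> I" for i
        using that a(1) h(1) g' by (auto simp: b_def I(1) intro!: sum_mem minus_mem)
      obtain i where "i \<in> I'" "a i \<notin> P" using a(2) by auto
      then have "b i \<notin> P" using prime_mult[OF P, of "a i" h] a(1) h bI' by auto
      then show "\<exists>i\<in>I. b i \<notin> P" using \<open>i \<in> I'\<close> I by auto
      fix f' assume f': "f' \<in> insert f F"
      show "(\<Sum>i\<in>I. b i * g i f') \<in> P"
      proof (cases "f' = f")
        case True
        have "(\<Sum>i\<in>I. b i * g i f) = 0"
          unfolding split using a(1) g' h
          by (intro sum.neutral) (auto simp: h_def[symmetric] mult.assoc comm[of h])
        then show ?thesis using True ideal_zero[OF iP] by simp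
      next
        case False
        then have "(\<Sum>i\<in>I'. a i * g2 i f') \<in> P" using a(3) f' by auto
        then show ?thesis unfolding split by (simp add: g2_def algebra_simps)
      qed
    qed
  qed
qed

text \<open>The lowest coefficient outside \<open>Q1\<close> would lie in \<open>Q2\<close>, since all higher terms contain a
  factor \<open>c\<close>.\<close>

lemma (in comm_subring) coeffs_mem_prime:
  assumes Q1: "g_prime R Q1" and Q2: "g_ideal R Q2" and "Q1 \<subseteq> Q2"
    and c: "c \<in> Q2" "c \<notin> Q1"
    and "\<And>i. i \<le> n \<Longrightarrow> b i \<in> R" "\<And>i. i \<le> n \<Longrightarrow> b i \<in> Q2 \<Longrightarrow> b i \<in> Q1"
    and "(\<Sum>i\<le>n. b i * c ^ i) \<in> Q1"
  shows "i \<le> n \<Longrightarrow> b i \<in> Q1"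
  using assms(6-)
proof (induction n arbitrary: b i)
  case 0
  then show ?case by simp
next
  case (Suc n)
  have iQ1: "g_ideal R Q1" using Q1 by (rule prime_ideal)
  have cR: "c \<in> R" using c Q2 ideal_subset by auto
  let ?s = "\<Sum>i\<le>n. b (Suc i) * c ^ i"
  have sR: "?s \<in> R" using Suc.prems(2) cR by (intro sum_mem) auto
  have eq: "(\<Sum>i\<le>Suc n. b i * c ^ i) = b 0 + ?s * c"
    by (simp add: sum.atMost_Suc_shift sum_distrib_right mult.assoc power_Suc2 del: sum.atMost_Suc power_Suc)
  have sc: "?s * c \<in> Q2" using ideal_mult_left[OF Q2 sR c(1)] .
  \<comment> \<open>Modulo \<open>Q2\<close> only the constant term survives, so \<open>b 0\<close>
    lies in \<open>Q2\<close> and hence in \<open>Q1\<close>.\<close>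
  have "b 0 + ?s * c \<in> Q2" using Suc.prems(4) \<open>Q1 \<subseteq> Q2\<close> eq by auto
  from ideal_diff[OF Q2 this sc] have "b 0 \<in> Q2" by simp
  then have b0: "b 0 \<in> Q1" using Suc.prems(3) by simp
  have "b 0 + ?s * c \<in> Q1" using Suc.prems(4) eq by simp
  from ideal_diff[OF iQ1 this b0] have "?s * c \<in> Q1" by simp
  \<comment> \<open>\<open>c\<close> cancels modulo the prime \<open>Q1\<close>, which leaves a
    relation with one coefficient fewer.\<close>
  then have "?s \<in> Q1" using prime_mult[OF Q1 sR cR] c by auto
  then have "b (Suc j) \<in> Q1" if "j \<le> n" for j
    using Suc.IH[of j "\<lambda>i. b (Suc i)"] Suc.prems that by auto
  then show ?case using b0 Suc.prems(1) by (cases i) auto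
qed

section \<open>Finite extensions\<close>

text \<open>\<open>E\<close> is only required to be module-finite over \<open>\<phi> ` R\<close> modulo an ideal \<open>N\<close>, so the
  prime correspondence concerns primes of \<open>E\<close> containing \<open>N\<close>.\<close>

locale finite_mod_extension = R: comm_subring R + E: comm_subring E
  for R :: "'a::ring_1 set" and E :: "'b::ring_1 set" +
  fixes \<phi> :: "'a \<Rightarrow> 'b" and N :: "'b set" and F :: "'b set"
  assumes hom_mem [simp]: "x \<in> R \<Longrightarrow> \<phi> x \<in> E"
    and hom_one [simp]: "\<phi> 1 = 1"
    and hom_add: "x \<in> R \<Longrightarrow> y \<in> R \<Longrightarrow> \<phi> (x + y) = \<phi> x + \<phi> y"
    and hom_mult: "x \<in> R \<Longrightarrow> y \<in> R \<Longrightarrow> \<phi> (x * y) = \<phi> x * \<phi> y"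
    and ideal_N: "g_ideal E N"
    and finite_F: "finite F" and F_subset: "F \<subseteq> E"
    and generates: "c \<in> E \<Longrightarrow> \<exists>g. (\<forall>f\<in>F. g f \<in> R) \<and> c - (\<Sum>f\<in>F. \<phi> (g f) * f) \<in> N"
begin

lemma hom_zero [simp]: "\<phi> 0 = 0"
  using hom_add[of 0 0] by simp

lemma hom_minus: "x \<in> R \<Longrightarrow> \<phi> (- x) = - \<phi> x"
  using hom_add[of x "- x"] by (simp add: eq_neg_iff_add_eq_0 add.commute)

lemma hom_diff: "x \<in> R \<Longrightarrow> y \<in> R \<Longrightarrow> \<phi> (x - y) = \<phi> x - \<phi> y"
  using hom_add[of x "- y"] by (simp add: hom_minus)

lemma hom_sum: "(\<And>i. i \<in> I \<Longrightarrow> f i \<in> R) \<Longrightarrow> \<phi> (sum f I) = (\<Sum>i\<in>I. \<phi> (f i))"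
  by (induction I rule: infinite_finite_induct) (auto simp: hom_add R.sum_mem)

definition contr :: "'b set \<Rightarrow> 'a set" where
  "contr Q = {x \<in> R. \<phi> x \<in> Q}"

lemma contr_prime:
  assumes Q: "g_prime E Q"
  shows "g_prime R (contr Q)"
proof -
  have iQ: "g_ideal E Q" using Q by (rule E.prime_ideal)
  have "g_ideal R (contr Q)"
    using E.ideal_zero[OF iQ] E.ideal_add[OF iQ] E.ideal_mult_left[OF iQ]
    by (intro R.idealI) (auto simp: contr_def hom_add hom_mult)
  moreover have "1 \<notin> contr Q" using E.prime_one[OF Q] by (simp add: contr_def)
  then have "contr Q \<noteq> R" using R.one_mem by metis
  ultimately show ?thesis
    using E.prime_mult[OF Q] by (auto simp: g_prime_def contr_def hom_mult)
qed

text \<open>Nakayama's lemma for the localization at \<open>P\<close>, by eliminating one generator at a time.\<close>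

lemma nakayama:
  assumes P: "g_prime R P" and Q: "g_ideal E Q"
    and "finite A" "A \<subseteq> E" "s \<in> R" "s \<notin> P"
    and "\<And>f f'. f \<in> A \<Longrightarrow> f' \<in> A \<Longrightarrow> p f f' \<in> P"
    and "\<And>f. f \<in> A \<Longrightarrow> \<phi> s * f - (\<Sum>f'\<in>A. \<phi> (p f f') * f') \<in> Q"
  shows "\<exists>t\<in>R - P. \<forall>f\<in>A. \<phi> t * f \<in> Q"
  using assms(3-)
proof (induction A arbitrary: s p rule: finite_induct)
  case empty
  then show ?case by auto
next
  case (insert f0 A)
  have iP: "g_ideal R P" using P by (rule R.prime_ideal)
  have p: "p f f' \<in> P" "p f f' \<in> R" if "f \<in> insert f0 A" "f' \<in> insert f0 A" for f f'
    using insert.prems(4)[OF that] R.ideal_subset[OF iP] by auto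
  have f0: "f0 \<in> E" and A: "A \<subseteq> E" using insert.prems by auto
  have rel: "\<phi> s * f - (\<phi> (p f f0) * f0 + (\<Sum>f'\<in>A. \<phi> (p f f') * f')) \<in> Q"
    if "f \<in> insert f0 A" for f
    using insert.prems(5)[OF that] insert.hyps by simp
  \<comment> \<open>Moving the diagonal term to the left solves for \<open>f0\<close>;
    \<open>s1\<close> stays outside \<open>P\<close> because it differs from \<open>s\<close> by an
    element of \<open>P\<close>.\<close>
  define s1 where "s1 = s - p f0 f0"
  have s1: "s1 \<in> R" "s1 \<notin> P"
  proof -
    show "s1 \<in> R" using insert.prems p by (simp add: s1_def)
    show "s1 \<notin> P"
      using R.ideal_add[OF iP, of s1 "p f0 f0"] p insert.prems by (auto simp: s1_def)
  qed
  have rel0: "\<phi> s1 * f0 - (\<Sum>f'\<in>A. \<phi> (p f0 f') * f') \<in> Q"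
    using rel[of f0] p insert.prems by (simp add: s1_def hom_diff algebra_simps)
  \<comment> \<open>The coefficients that result from multiplying the relation for \<open>f\<close>
    by \<open>s1\<close> and substituting \<open>rel0\<close>.\<close>
  define p' where "p' f f' = s1 * p f f' + p f f0 * p f0 f'" for f f'
  have p': "p' f f' \<in> P" if "f \<in> A" "f' \<in> A" for f f'
    using that p s1 by (auto simp: p'_def intro!: R.ideal_add[OF iP] R.ideal_mult_left[OF iP])
  have ss: "s1 * s \<in> R" "s1 * s \<notin> P"
    using s1 insert.prems R.prime_mult[OF P, of s1 s] by auto
  have "\<phi> (s1 * s) * f - (\<Sum>f'\<in>A. \<phi> (p' f f') * f') \<in> Q" if f: "f \<in> A" for f
  proof -
    have 1: "\<phi> s1 * (\<phi> s * f - (\<phi> (p f f0) * f0 + (\<Sum>f'\<in>A. \<phi> (p f f') * f'))) \<in> Q"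
      using rel f s1 by (intro E.ideal_mult_left[OF Q]) auto
    have 2: "\<phi> (p f f0) * (\<phi> s1 * f0 - (\<Sum>f'\<in>A. \<phi> (p f0 f') * f')) \<in> Q"
      using rel0 f p by (intro E.ideal_mult_left[OF Q]) auto
    have cm: "\<phi> s1 * (\<phi> (p f f0) * f0) = \<phi> (p f f0) * (\<phi> s1 * f0)"
      using E.comm[of "\<phi> s1" "\<phi> (p f f0)"] p f s1 by (simp flip: mult.assoc)
    have "(\<Sum>f'\<in>A. \<phi> (p' f f') * f') = \<phi> s1 * (\<Sum>f'\<in>A. \<phi> (p f f') * f')
        + \<phi> (p f f0) * (\<Sum>f'\<in>A. \<phi> (p f0 f') * f')"
      using p f s1 by (auto simp: sum_distrib_left p'_def hom_add hom_mult distrib_right mult.assoc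
          sum.distrib[symmetric] intro!: sum.cong)
    then have "\<phi> (s1 * s) * f - (\<Sum>f'\<in>A. \<phi> (p' f f') * f') =
       \<phi> s1 * (\<phi> s * f - (\<phi> (p f f0) * f0 + (\<Sum>f'\<in>A. \<phi> (p f f') * f')))
       + \<phi> (p f f0) * (\<phi> s1 * f0 - (\<Sum>f'\<in>A. \<phi> (p f0 f') * f'))"
      using cm s1 insert.prems by (simp add: hom_mult algebra_simps)
    then show ?thesis using E.ideal_add[OF Q 1 2] by simp
  qed
  then obtain t where t: "t \<in> R" "t \<notin> P" "\<And>f. f \<in> A \<Longrightarrow> \<phi> t * f \<in> Q"
    using insert.IH[of "s1 * s" p'] A ss p' by blast
  have "\<phi> (t * s1) * f \<in> Q" if f: "f \<in> insert f0 A" for f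
  proof (cases "f = f0")
    case False
    have "\<phi> (t * s1) * f = \<phi> s1 * (\<phi> t * f)"
      using t s1 E.comm[of "\<phi> t" "\<phi> s1"] by (simp add: hom_mult flip: mult.assoc)
    then show ?thesis using False f t s1 E.ideal_mult_left[OF Q] by auto
  next
    case True
    \<comment> \<open>By \<open>rel0\<close>, \<open>\<phi> s1 * f0\<close> is modulo
      \<open>Q\<close> a combination of elements that \<open>\<phi> t\<close> already sends into
      \<open>Q\<close>.\<close>
    have "\<phi> t * (\<phi> (p f0 f') * f') \<in> Q" if "f' \<in> A" for f'
    proof -
      have "\<phi> t * (\<phi> (p f0 f') * f') = \<phi> (p f0 f') * (\<phi> t * f')"
        using t p that E.comm[of "\<phi> t" "\<phi> (p f0 f')"] by (simp flip: mult.assoc)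
      then show ?thesis using that t p E.ideal_mult_left[OF Q] by auto
    qed
    then have "\<phi> t * (\<Sum>f'\<in>A. \<phi> (p f0 f') * f') \<in> Q"
      unfolding sum_distrib_left by (intro E.ideal_sum[OF Q]) auto
    moreover have "\<phi> t * (\<phi> s1 * f0 - (\<Sum>f'\<in>A. \<phi> (p f0 f') * f')) \<in> Q"
      using rel0 t by (intro E.ideal_mult_left[OF Q]) auto
    ultimately have "\<phi> t * (\<phi> s1 * f0 - (\<Sum>f'\<in>A. \<phi> (p f0 f') * f')) + \<phi> t * (\<Sum>f'\<in>A. \<phi> (p f0 f') * f') \<in> Q"
      by (rule E.ideal_add[OF Q, rotated])
    then show ?thesis using True t s1 by (simp add: hom_mult algebra_simps)
  qed
  moreover have "t * s1 \<in> R" "t * s1 \<notin> P" using R.prime_mult[OF P, of t s1] t s1 by auto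
  ultimately show ?case by blast
qed

text \<open>A maximal \<open>Q\<close> over \<open>M\<close> avoiding the image of
  \<open>R - P\<close> contracts into \<open>P\<close>. Nakayama's lemma shows that adjoining the
  image of \<open>P\<close> to \<open>Q\<close> still avoids that set, so maximality gives
  equality.\<close>

lemma going_up:
  assumes M: "g_ideal E M" "N \<subseteq> M" and P: "g_prime R P" and MP: "contr M \<subseteq> P"
  obtains Q where "g_prime E Q" "M \<subseteq> Q" "contr Q = P"
proof -
  have iP: "g_ideal R P" using P by (rule R.prime_ideal)
  have PR: "P \<subseteq> R" using R.ideal_subset[OF iP] .
  define S where "S = \<phi> ` (R - P)"
  have "1 \<in> S" using R.prime_one[OF P] R.one_mem by (force simp: S_def)
  moreover have "x * y \<in> S" if xy: "x \<in> S" "y \<in> S" for x y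
  proof -
    obtain a b where ab: "a \<in> R" "a \<notin> P" "b \<in> R" "b \<notin> P" "x = \<phi> a" "y = \<phi> b"
      using xy by (auto simp: S_def)
    then have "x * y = \<phi> (a * b)" "a * b \<in> R - P"
      using R.prime_mult[OF P, of a b] by (auto simp: hom_mult)
    then show ?thesis by (auto simp: S_def)
  qed
  moreover have "M \<inter> S = {}" using MP by (auto simp: S_def contr_def)
  ultimately obtain Q where Q: "g_prime E Q" "M \<subseteq> Q" "Q \<inter> S = {}"
    "\<And>Q'. g_ideal E Q' \<Longrightarrow> Q \<subseteq> Q' \<Longrightarrow> Q' \<inter> S = {} \<Longrightarrow> Q' = Q"
    using E.exists_prime_avoiding[OF M(1), of S] by metis
  have iQ: "g_ideal E Q" using Q(1) by (rule E.prime_ideal)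
  have NQ: "N \<subseteq> Q" using M Q by auto
  have sub: "contr Q \<subseteq> P" using Q(3) by (auto simp: S_def contr_def)
  \<comment> \<open>This is \<open>Q\<close> plus the extension of \<open>P\<close>, written through
    the generators \<open>F\<close> so that \<open>nakayama\<close> applies.\<close>
  define Q' where "Q' = {c \<in> E. \<exists>p. (\<forall>f\<in>F. p f \<in> P) \<and> c - (\<Sum>f\<in>F. \<phi> (p f) * f) \<in> Q}"
  have scaled: "\<phi> p * d \<in> Q'" if p: "p \<in> P" and d: "d \<in> E" for p d
  proof -
    obtain g where g: "\<forall>f\<in>F. g f \<in> R" "d - (\<Sum>f\<in>F. \<phi> (g f) * f) \<in> N"
      using generates[OF d] by auto
    have pR: "p \<in> R" using p PR by auto
    have "\<phi> p * (d - (\<Sum>f\<in>F. \<phi> (g f) * f)) \<in> Q"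
      using g NQ pR by (intro E.ideal_mult_left[OF iQ]) auto
    also have "\<phi> p * (d - (\<Sum>f\<in>F. \<phi> (g f) * f)) = \<phi> p * d - (\<Sum>f\<in>F. \<phi> (p * g f) * f)"
      using g pR by (auto simp: right_diff_distrib sum_distrib_left hom_mult mult.assoc intro!: sum.cong)
    finally show ?thesis using g p pR d R.ideal_mult_right[OF iP]
      by (auto simp: Q'_def intro!: exI[of _ "\<lambda>f. p * g f"])
  qed
  have Q'_add: "x + y \<in> Q'" if xy: "x \<in> Q'" "y \<in> Q'" for x y
  proof -
    obtain p q where pq: "\<forall>f\<in>F. p f \<in> P" "x - (\<Sum>f\<in>F. \<phi> (p f) * f) \<in> Q"
        "\<forall>f\<in>F. q f \<in> P" "y - (\<Sum>f\<in>F. \<phi> (q f) * f) \<in> Q"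
      using xy by (auto simp: Q'_def)
    have "(\<Sum>f\<in>F. \<phi> (p f + q f) * f) = (\<Sum>f\<in>F. \<phi> (p f) * f) + (\<Sum>f\<in>F. \<phi> (q f) * f)"
      using pq PR by (auto simp: hom_add subset_iff distrib_right simp flip: sum.distrib intro!: sum.cong)
    then have "x + y - (\<Sum>f\<in>F. \<phi> (p f + q f) * f) \<in> Q"
      using E.ideal_add[OF iQ pq(2,4)] by (simp add: algebra_simps)
    then show ?thesis using pq xy R.ideal_add[OF iP]
      by (auto simp: Q'_def intro!: exI[of _ "\<lambda>f. p f + q f"])
  qed
  have QQ': "Q \<subseteq> Q'"
    using R.ideal_zero[OF iP] E.ideal_subset[OF iQ]
    by (auto simp: Q'_def intro!: exI[of _ "\<lambda>_. 0"])
  have Q'_sum: "sum h A \<in> Q'" if "\<And>a. a \<in> A \<Longrightarrow> h a \<in> Q'" for h :: "'b \<Rightarrow> 'b" and A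
    using that QQ' E.ideal_zero[OF iQ]
    by (induction A rule: infinite_finite_induct) (auto intro!: Q'_add)
  have Q'_mult: "d * x \<in> Q'" if x: "x \<in> Q'" and d: "d \<in> E" for x d
  proof -
    obtain p where p: "\<forall>f\<in>F. p f \<in> P" "x - (\<Sum>f\<in>F. \<phi> (p f) * f) \<in> Q"
      using x by (auto simp: Q'_def)
    have "d * (\<phi> (p f) * f) \<in> Q'" if f: "f \<in> F" for f
    proof -
      have "d * (\<phi> (p f) * f) = \<phi> (p f) * (d * f)"
        using E.comm[of d "\<phi> (p f)"] d f p PR by (auto simp flip: mult.assoc)
      then show ?thesis using scaled[of "p f" "d * f"] f p d F_subset by auto
    qed
    then have "(\<Sum>f\<in>F. d * (\<phi> (p f) * f)) \<in> Q'" by (rule Q'_sum)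
    moreover have "d * (x - (\<Sum>f\<in>F. \<phi> (p f) * f)) \<in> Q'"
      using E.ideal_mult_left[OF iQ d p(2)] QQ' by auto
    ultimately have "d * (x - (\<Sum>f\<in>F. \<phi> (p f) * f)) + (\<Sum>f\<in>F. d * (\<phi> (p f) * f)) \<in> Q'"
      by (intro Q'_add)
    then show ?thesis by (simp add: right_diff_distrib sum_distrib_left)
  qed
  have iQ': "g_ideal E Q'"
  proof (rule E.idealI)
    show "Q' \<subseteq> E" by (auto simp: Q'_def)
    show "0 \<in> Q'" using QQ' E.ideal_zero[OF iQ] by auto
  qed (fact Q'_add Q'_mult[rotated])+
  have "Q' \<inter> S = {}"
  proof (rule ccontr)
    assume "Q' \<inter> S \<noteq> {}"
    then obtain s where s: "s \<in> R" "s \<notin> P" "\<phi> s \<in> Q'" by (auto simp: S_def)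
    \<comment> \<open>Multiplying \<open>\<phi> s\<close> by each generator stays in the ideal
      \<open>Q'\<close>; this produces the square system for \<open>nakayama\<close>.\<close>
    have "\<exists>p. (\<forall>f'\<in>F. p f' \<in> P) \<and> \<phi> s * f - (\<Sum>f'\<in>F. \<phi> (p f') * f') \<in> Q" if f: "f \<in> F" for f
      using E.ideal_mult_right[OF iQ' _ s(3), of f] f F_subset by (auto simp: Q'_def)
    then obtain p where "\<And>f f'. f \<in> F \<Longrightarrow> f' \<in> F \<Longrightarrow> p f f' \<in> P"
        "\<And>f. f \<in> F \<Longrightarrow> \<phi> s * f - (\<Sum>f'\<in>F. \<phi> (p f f') * f') \<in> Q"
      by metis
    then obtain t where t: "t \<in> R" "t \<notin> P" "\<forall>f\<in>F. \<phi> t * f \<in> Q"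
      using nakayama[OF P iQ finite_F F_subset s(1,2), of p] by auto
    \<comment> \<open>Since 1 is a combination of the generators modulo \<open>N\<close>, sending
      all generators into \<open>Q\<close> puts \<open>\<phi> t\<close> itself there.\<close>
    obtain g where g: "\<forall>f\<in>F. g f \<in> R" "1 - (\<Sum>f\<in>F. \<phi> (g f) * f) \<in> N"
      using generates[OF E.one_mem] by auto
    have "\<phi> t * (\<phi> (g f) * f) \<in> Q" if f: "f \<in> F" for f
    proof -
      have "\<phi> t * (\<phi> (g f) * f) = \<phi> (g f) * (\<phi> t * f)"
        using E.comm[of "\<phi> t" "\<phi> (g f)"] t f g by (auto simp flip: mult.assoc)
      then show ?thesis using t f g E.ideal_mult_left[OF iQ] by auto
    qed
    then have "(\<Sum>f\<in>F. \<phi> t * (\<phi> (g f) * f)) \<in> Q" by (rule E.ideal_sum[OF iQ])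
    moreover have "\<phi> t * (1 - (\<Sum>f\<in>F. \<phi> (g f) * f)) \<in> Q"
      using g NQ t by (intro E.ideal_mult_left[OF iQ]) auto
    ultimately have "\<phi> t * (1 - (\<Sum>f\<in>F. \<phi> (g f) * f)) + (\<Sum>f\<in>F. \<phi> t * (\<phi> (g f) * f)) \<in> Q"
      by (intro E.ideal_add[OF iQ])
    then have "\<phi> t \<in> Q" by (simp add: right_diff_distrib sum_distrib_left)
    then show False using t sub by (auto simp: contr_def)
  qed
  then have "Q' = Q" using Q(4) iQ' QQ' by blast
  then have "P \<subseteq> contr Q" using scaled[of _ 1] PR by (auto simp: contr_def)
  then show ?thesis using that Q sub by blast
qed

text \<open>More powers of some \<open>c\<close> in \<open>Q2 - Q1\<close> than generators yield a
  polynomial relation for \<open>c\<close> modulo \<open>Q1\<close> with a coefficient outside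
  \<open>contr Q1\<close>. Were the contractions equal, \<open>coeffs_mem_prime\<close> would put
  every coefficient into \<open>Q1\<close>.\<close>

lemma incomparability:
  assumes Q1: "g_prime E Q1" and Q2: "g_prime E Q2" and "N \<subseteq> Q1" "Q1 \<subset> Q2"
  shows "contr Q1 \<subset> contr Q2"
proof -
  have iQ1: "g_ideal E Q1" and iQ2: "g_ideal E Q2" using Q1 Q2 by (auto intro: E.prime_ideal)
  obtain c where c: "c \<in> Q2" "c \<notin> Q1" using assms by auto
  have cE: "c \<in> E" using c E.ideal_subset[OF iQ2] by auto
  define P where "P = contr Q1"
  have P: "g_prime R P" unfolding P_def using contr_prime[OF Q1] .
  have "\<exists>g. \<forall>i. (\<forall>f\<in>F. g i f \<in> R) \<and> c ^ i - (\<Sum>f\<in>F. \<phi> (g i f) * f) \<in> N"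
    using generates cE by (intro choice) auto
  then obtain g where g: "\<And>i f. f \<in> F \<Longrightarrow> g i f \<in> R"
      "\<And>i. c ^ i - (\<Sum>f\<in>F. \<phi> (g i f) * f) \<in> N"
    by blast
  \<comment> \<open>The exponents 0 to \<open>n\<close> give \<open>n + 1\<close> unknowns against
    \<open>n\<close> equations.\<close>
  define n where "n = card F"
  obtain a where a: "\<forall>i\<in>{..n}. a i \<in> R" "\<exists>i\<in>{..n}. a i \<notin> P"
      "\<forall>f\<in>F. (\<Sum>i\<le>n. a i * g i f) \<in> P"
    using R.linear_system_nontrivial_solution[OF P finite_F, of "{..n}" g] g by (auto simp: n_def)
  \<comment> \<open>The first sum lies in \<open>Q1\<close> because the errors lie in
    \<open>N\<close>, the second because the inner sums lie in \<open>P\<close>.\<close>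
  have "(\<Sum>i\<le>n. \<phi> (a i) * c ^ i) =
      (\<Sum>i\<le>n. \<phi> (a i) * (c ^ i - (\<Sum>f\<in>F. \<phi> (g i f) * f))) + (\<Sum>f\<in>F. \<phi> (\<Sum>i\<le>n. a i * g i f) * f)"
  proof -
    have "\<phi> (\<Sum>i\<le>n. a i * g i f) = (\<Sum>i\<le>n. \<phi> (a i) * \<phi> (g i f))" if "f \<in> F" for f
      using that a g by (subst hom_sum) (auto simp: hom_mult)
    then have "(\<Sum>f\<in>F. \<phi> (\<Sum>i\<le>n. a i * g i f) * f) = (\<Sum>f\<in>F. \<Sum>i\<le>n. \<phi> (a i) * (\<phi> (g i f) * f))"
      by (simp add: sum_distrib_right mult.assoc)
    also have "\<dots> = (\<Sum>i\<le>n. \<phi> (a i) * (\<Sum>f\<in>F. \<phi> (g i f) * f))"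
      by (subst sum.swap) (simp add: sum_distrib_left)
    finally show ?thesis by (simp add: right_diff_distrib sum_subtractf)
  qed
  moreover have "(\<Sum>i\<le>n. \<phi> (a i) * (c ^ i - (\<Sum>f\<in>F. \<phi> (g i f) * f))) \<in> Q1"
    using a g \<open>N \<subseteq> Q1\<close> by (auto intro!: E.ideal_sum[OF iQ1] E.ideal_mult_left[OF iQ1])
  moreover have "(\<Sum>f\<in>F. \<phi> (\<Sum>i\<le>n. a i * g i f) * f) \<in> Q1"
    using a F_subset by (auto simp: P_def contr_def intro!: E.ideal_sum[OF iQ1] E.ideal_mult_right[OF iQ1])
  ultimately have rel: "(\<Sum>i\<le>n. \<phi> (a i) * c ^ i) \<in> Q1"
    by (simp only: E.ideal_add[OF iQ1])
  have le: "contr Q1 \<subseteq> contr Q2" using assms by (auto simp: contr_def)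
  show ?thesis
  proof (rule ccontr)
    assume "\<not> ?thesis"
    then have "\<phi> (a i) \<in> Q2 \<Longrightarrow> \<phi> (a i) \<in> Q1" if "i \<le> n" for i
      using le a that by (auto simp: contr_def)
    then have "\<phi> (a i) \<in> Q1" if "i \<le> n" for i
      using E.coeffs_mem_prime[OF Q1 iQ2 _ c, of n "\<lambda>i. \<phi> (a i)" i] a rel assms that by auto
    then show False using a by (auto simp: P_def contr_def)
  qed
qed

end

text \<open>A prime strictly above the \<open>\<phi>\<close>-contraction of \<open>Q\<close> lifts
  by going up to a prime strictly above \<open>Q\<close>, whose \<open>\<psi>\<close>-contraction
  grows strictly by incomparability. Induction on \<open>i\<close> repeats this step along
  chains.\<close>

lemma contr_Zc_transfer:
  assumes "finite_mod_extension R E \<phi> N F" and "finite_mod_extension R E \<psi> N F'"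
    and "g_prime E Q" "N \<subseteq> Q" "{x \<in> R. \<psi> x \<in> Q} \<in> Zc R i"
  shows "{x \<in> R. \<phi> x \<in> Q} \<in> Zc R i"
proof -
  interpret L: finite_mod_extension R E \<phi> N F by fact
  interpret R: finite_mod_extension R E \<psi> N F' by fact
  have step: "\<exists>Q'. g_prime E Q' \<and> N \<subseteq> Q' \<and> L.contr Q' = P \<and> R.contr Q \<subset> R.contr Q'"
    if Q: "g_prime E Q" "N \<subseteq> Q" and P: "g_prime R P" "L.contr Q \<subset> P" for Q P
  proof -
    obtain Q' where Q': "g_prime E Q'" "Q \<subseteq> Q'" "L.contr Q' = P"
      using L.going_up[OF L.E.prime_ideal[OF Q(1)] Q(2) P(1)] P(2) by blast
    then have "Q \<subset> Q'" using P(2) by blast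
    then show ?thesis using R.incomparability[OF Q(1) Q'(1) Q(2)] Q' Q(2) by blast
  qed
  have "g_prime E Q \<Longrightarrow> N \<subseteq> Q \<Longrightarrow> R.contr Q \<in> Zc R i \<Longrightarrow> L.contr Q \<in> Zc R i"
  proof (induction i arbitrary: Q)
    case 0
    have False if P: "g_prime R P" "L.contr Q \<subset> P" for P
    proof -
      obtain Q' where Q': "g_prime E Q'" "R.contr Q \<subset> R.contr Q'"
        using step[OF 0(1,2) P] by blast
      then show False using 0(3) R.contr_prime[OF Q'(1)] unfolding L.R.Zc_0_iff by blast
    qed
    then show ?case unfolding L.R.Zc_0_iff using L.contr_prime[OF 0(1)] by blast
  next
    case (Suc i)
    have "P \<in> Zc R i" if P: "g_prime R P" "L.contr Q \<subset> P" for P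
    proof -
      obtain Q' where Q': "g_prime E Q'" "N \<subseteq> Q'" "L.contr Q' = P" "R.contr Q \<subset> R.contr Q'"
        using step[OF Suc.prems(1,2) P] by blast
      then have "R.contr Q' \<in> Zc R i"
        using Suc.prems(3) R.contr_prime[OF Q'(1)] unfolding L.R.Zc_Suc_iff by blast
      then show ?thesis using Suc.IH[OF Q'(1,2)] Q'(3) by simp
    qed
    then show ?case unfolding L.R.Zc_Suc_iff using L.contr_prime[OF Suc.prems(1)] by blast
  qed
  then show ?thesis using assms by (simp add: L.contr_def R.contr_def)
qed

section \<open>The ring of two-sided multiplications\<close>

text \<open>Additive endomorphisms form a type so that left and right multiplications share one ring
  of class \<open>ring_1\<close>, as \<open>comm_subring\<close> requires.\<close>

typedef (overloaded) 'a endo = "{f :: 'a::ring_1 \<Rightarrow> 'a. \<forall>x y. f (x + y) = f x + f y}"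
  morphisms app Endo
  by (rule exI[of _ "\<lambda>x. x"]) simp

setup_lifting type_definition_endo

instantiation endo :: (ring_1) ring_1
begin

lift_definition zero_endo :: "'a endo" is "\<lambda>x. 0" by simp
lift_definition one_endo :: "'a endo" is "\<lambda>x. x" by simp
lift_definition plus_endo :: "'a endo \<Rightarrow> 'a endo \<Rightarrow> 'a endo" is "\<lambda>f g x. f x + g x"
  by (simp add: algebra_simps)
lift_definition uminus_endo :: "'a endo \<Rightarrow> 'a endo" is "\<lambda>f x. - f x" by simp
lift_definition minus_endo :: "'a endo \<Rightarrow> 'a endo \<Rightarrow> 'a endo" is "\<lambda>f g x. f x - g x"
  by (simp add: algebra_simps)
lift_definition times_endo :: "'a endo \<Rightarrow> 'a endo \<Rightarrow> 'a endo" is "\<lambda>f g x. f (g x)" by simp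

lemma app_ring_ops [simp]:
  "app (0 :: 'a endo) x = 0" "app (1 :: 'a endo) x = x" "app (f + g) x = app f x + app g x"
  "app (- f) x = - app f x" "app (f - g) x = app f x - app g x"
  "app (f * g) x = app f (app g x)"
  by (transfer, rule refl)+

lemma app_add: "app (f :: 'a endo) (x + y) = app f x + app f y"
  by transfer simp

lemma endo_eqI: "(\<And>x. app f x = app g x) \<Longrightarrow> f = (g :: 'a endo)"
  by transfer auto

instance
proof
  show "(0 :: 'a endo) \<noteq> 1"
  proof
    assume "(0 :: 'a endo) = 1"
    then have "app (0 :: 'a endo) 1 = app 1 1" by simp
    then show False by simp
  qed
qed (rule endo_eqI, simp add: app_add add.assoc add.commute)+

end

lift_definition lmul :: "'a::ring_1 \<Rightarrow> 'a endo" is "\<lambda>a x. a * x" by (simp add: distrib_left)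
lift_definition rmul :: "'a::ring_1 \<Rightarrow> 'a endo" is "\<lambda>b x. x * b" by (simp add: distrib_right)

lemma app_mul [simp]: "app (lmul a) x = a * x" "app (rmul a) x = x * a"
  by (transfer, rule refl)+

lemma app_zero [simp]: "app f 0 = 0"
  using app_add[of f 0 0] by simp

lemma app_sum: "app (sum f I) x = (\<Sum>i\<in>I. app (f i) x)"
  by (induction I rule: infinite_finite_induct) auto

lemma lmul_hom [simp]: "lmul 1 = 1" "lmul (a + b) = lmul a + lmul b" "lmul (a * b) = lmul a * lmul b"
  and rmul_hom [simp]: "rmul 1 = 1" "rmul (a + b) = rmul a + rmul b" "rmul (a * b) = rmul b * rmul a"
  by (rule endo_eqI; simp add: algebra_simps)+

text \<open>For commutative \<open>G\<close> this is the image of G \<otimes> G in the endomorphism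
  ring, obtained without constructing the tensor product.\<close>

inductive_set bimod_ring :: "'a::ring_1 set \<Rightarrow> 'a endo set" for G where
  lmul: "a \<in> G \<Longrightarrow> lmul a \<in> bimod_ring G"
| rmul: "a \<in> G \<Longrightarrow> rmul a \<in> bimod_ring G"
| add: "f \<in> bimod_ring G \<Longrightarrow> g \<in> bimod_ring G \<Longrightarrow> f + g \<in> bimod_ring G"
| mult: "f \<in> bimod_ring G \<Longrightarrow> g \<in> bimod_ring G \<Longrightarrow> f * g \<in> bimod_ring G"
| minus: "f \<in> bimod_ring G \<Longrightarrow> - f \<in> bimod_ring G"

lemma commute_bimod_ring:
  assumes "\<And>a. a \<in> G \<Longrightarrow> f * lmul a = lmul a * f" "\<And>a. a \<in> G \<Longrightarrow> f * rmul a = rmul a * f"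
    and "g \<in> bimod_ring G"
  shows "f * g = g * f"
  using assms(3)
proof induction
  case (mult g h)
  then show ?case by (metis mult.assoc)
qed (auto simp: assms algebra_simps)

context comm_subring
begin

lemma comm_subring_bimod_ring: "comm_subring (bimod_ring R)"
proof
  show "(1 :: 'a endo) \<in> bimod_ring R" using bimod_ring.lmul[OF one_mem] by simp
  \<comment> \<open>The generators are first shown to commute with the whole ring; a second use of
    \<open>commute_bimod_ring\<close> then covers arbitrary elements.\<close>
  have l: "lmul a * g = g * lmul a" if "a \<in> R" "g \<in> bimod_ring R" for a g
    by (rule commute_bimod_ring[OF _ _ that(2)])
       (auto intro!: endo_eqI simp: that comm[of a] mult.assoc simp flip: mult.assoc)
  have r: "rmul a * g = g * rmul a" if "a \<in> R" "g \<in> bimod_ring R" for a g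
    by (rule commute_bimod_ring[OF _ _ that(2)])
       (auto intro!: endo_eqI simp: that comm[of a] mult.assoc)
  show "f * g = g * f" if "f \<in> bimod_ring R" "g \<in> bimod_ring R" for f g
    by (rule commute_bimod_ring[OF _ _ that(2)]) (simp_all add: l r that)
qed (auto intro: bimod_ring.intros)

section \<open>The bimodule generated by u as a cyclic module over the two-sided
  multiplications\<close>

lemma bimod_memI:
  fixes n :: nat
  shows "(\<And>j. j < n \<Longrightarrow> a j \<in> R) \<Longrightarrow> (\<And>j. j < n \<Longrightarrow> b j \<in> R) \<Longrightarrow>
    (\<Sum>j<n. a j * u * b j) \<in> bimod R u"
  unfolding bimod_def by (rule CollectI, rule exI[of _ n], rule exI[of _ a], rule exI[of _ b]) simp

lemma bimod_mem_cases:
  assumes "x \<in> bimod R u"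
  obtains n :: nat and a b where "\<And>j. j < n \<Longrightarrow> a j \<in> R" "\<And>j. j < n \<Longrightarrow> b j \<in> R"
    "x = (\<Sum>j<n. a j * u * b j)"
  using assms unfolding bimod_def by blast

lemma generator_mem_bimod: "u \<in> bimod R u"
  using bimod_memI[of "Suc 0" "\<lambda>_. 1" "\<lambda>_. 1" u] by simp

text \<open>Sums here are indexed by initial segments of the naturals, so addition is obtained by
  appending single terms.\<close>

lemma bimod_add_term:
  assumes "x \<in> bimod R u" "c \<in> R" "d \<in> R"
  shows "x + c * u * d \<in> bimod R u"
proof -
  obtain n :: nat and a b where x: "\<And>j. j < n \<Longrightarrow> a j \<in> R" "\<And>j. j < n \<Longrightarrow> b j \<in> R"
    "x = (\<Sum>j<n. a j * u * b j)" using assms(1) by (rule bimod_mem_cases) blast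
  have "(\<Sum>j<Suc n. (a(n := c)) j * u * (b(n := d)) j) \<in> bimod R u"
    using x assms by (intro bimod_memI) (auto simp: less_Suc_eq)
  then show ?thesis using x by simp
qed

lemma bimod_add:
  assumes "x \<in> bimod R u" "y \<in> bimod R u"
  shows "x + y \<in> bimod R u"
proof -
  obtain n :: nat and a b where y: "\<And>j. j < n \<Longrightarrow> a j \<in> R" "\<And>j. j < n \<Longrightarrow> b j \<in> R"
    "y = (\<Sum>j<n. a j * u * b j)" using assms(2) by (rule bimod_mem_cases) blast
  have "x + (\<Sum>j<m. a j * u * b j) \<in> bimod R u" if "m \<le> n" for m
    using that
  proof (induction m)
    case 0
    then show ?case using assms by simp
  next
    case (Suc m)
    then show ?case using bimod_add_term[of _ u "a m" "b m"] y by (simp add: add.assoc[symmetric])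
  qed
  then show ?thesis using y by auto
qed

lemma bimod_lmult:
  assumes "x \<in> bimod R u" "c \<in> R"
  shows "c * x \<in> bimod R u"
proof -
  obtain n :: nat and a b where x: "\<And>j. j < n \<Longrightarrow> a j \<in> R" "\<And>j. j < n \<Longrightarrow> b j \<in> R"
    "x = (\<Sum>j<n. a j * u * b j)" using assms(1) by (rule bimod_mem_cases) blast
  then show ?thesis using bimod_memI[of n "\<lambda>j. c * a j" b u] assms
    by (simp add: sum_distrib_left mult.assoc)
qed

lemma bimod_rmult:
  assumes "x \<in> bimod R u" "c \<in> R"
  shows "x * c \<in> bimod R u"
proof -
  obtain n :: nat and a b where x: "\<And>j. j < n \<Longrightarrow> a j \<in> R" "\<And>j. j < n \<Longrightarrow> b j \<in> R"
    "x = (\<Sum>j<n. a j * u * b j)" using assms(1) by (rule bimod_mem_cases) blast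
  then show ?thesis using bimod_memI[of n a "\<lambda>j. b j * c" u] assms
    by (simp add: sum_distrib_right mult.assoc)
qed

lemma app_bimod: "f \<in> bimod_ring R \<Longrightarrow> x \<in> bimod R u \<Longrightarrow> app f x \<in> bimod R u"
proof (induction arbitrary: x rule: bimod_ring.induct)
  case (minus f)
  then show ?case using bimod_lmult[of "app f x" u "- 1"] by simp
qed (auto intro: bimod_add bimod_lmult bimod_rmult)

lemma bimod_eq_app:
  assumes "x \<in> bimod R u"
  shows "\<exists>f\<in>bimod_ring R. app f u = x"
proof -
  obtain n :: nat and a b where x: "\<And>j. j < n \<Longrightarrow> a j \<in> R" "\<And>j. j < n \<Longrightarrow> b j \<in> R"
    "x = (\<Sum>j<n. a j * u * b j)" using assms(1) by (rule bimod_mem_cases) blast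
  interpret E: comm_subring "bimod_ring R" by (rule comm_subring_bimod_ring)
  have "(\<Sum>j<n. lmul (a j) * rmul (b j)) \<in> bimod_ring R"
    using x by (auto intro!: E.sum_mem bimod_ring.intros)
  moreover have "app (\<Sum>j<n. lmul (a j) * rmul (b j)) u = x"
    using x by (simp add: app_sum mult.assoc)
  ultimately show ?thesis by blast
qed

text \<open>Evaluation at \<open>u\<close> identifies \<open>bimod_ring R\<close> modulo the annihilator of \<open>u\<close> with \<open>\<Gamma>u\<Gamma>\<close>,
  which turns generators of the bimodule into generators of the ring.\<close>

lemma finite_mod_extension_bimod_ring:
  assumes N: "g_ideal (bimod_ring R) N" "\<And>f. f \<in> bimod_ring R \<Longrightarrow> app f u = 0 \<Longrightarrow> f \<in> N"
    and \<phi>: "\<And>a. a \<in> R \<Longrightarrow> \<phi> a \<in> bimod_ring R" "\<phi> 1 = 1"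
      "\<And>a b. a \<in> R \<Longrightarrow> b \<in> R \<Longrightarrow> \<phi> (a + b) = \<phi> a + \<phi> b"
      "\<And>a b. a \<in> R \<Longrightarrow> b \<in> R \<Longrightarrow> \<phi> (a * b) = \<phi> a * \<phi> b"
    and F: "finite F" "F \<subseteq> bimod R u"
      "\<And>x. x \<in> bimod R u \<Longrightarrow> \<exists>c. (\<forall>f\<in>F. c f \<in> R) \<and> x = (\<Sum>f\<in>F. app (\<phi> (c f)) f)"
  shows "\<exists>F'. finite_mod_extension R (bimod_ring R) \<phi> N F'"
proof -
  interpret E: comm_subring "bimod_ring R" by (rule comm_subring_bimod_ring)
  have "\<exists>e. \<forall>f\<in>F. e f \<in> bimod_ring R \<and> app (e f) u = f"
    using bimod_eq_app F(2) by (intro bchoice) blast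
  then obtain e where e: "\<And>f. f \<in> F \<Longrightarrow> e f \<in> bimod_ring R" "\<And>f. f \<in> F \<Longrightarrow> app (e f) u = f"
    by blast
  have inj: "inj_on e F" using e(2) by (metis inj_onI)
  have "finite_mod_extension R (bimod_ring R) \<phi> N (e ` F)"
  proof
    fix c assume c: "c \<in> bimod_ring R"
    then obtain k where k: "\<forall>f\<in>F. k f \<in> R" "app c u = (\<Sum>f\<in>F. app (\<phi> (k f)) f)"
      using F(3)[OF app_bimod[OF c generator_mem_bimod]] by blast
    have eq: "(\<Sum>f\<in>e ` F. \<phi> (k (app f u)) * f) = (\<Sum>f\<in>F. \<phi> (k f) * e f)"
      using e inj by (simp add: sum.reindex)
    have "c - (\<Sum>f\<in>F. \<phi> (k f) * e f) \<in> bimod_ring R"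
      using c k e \<phi>(1) by (intro E.diff_mem E.sum_mem E.mult_mem) auto
    moreover have "app (c - (\<Sum>f\<in>F. \<phi> (k f) * e f)) u = 0"
      using k e by (simp add: app_sum)
    ultimately have "c - (\<Sum>f\<in>e ` F. \<phi> (k (app f u)) * f) \<in> N"
      unfolding eq by (rule N(2))
    then show "\<exists>g. (\<forall>f\<in>e ` F. g f \<in> R) \<and> c - (\<Sum>f\<in>e ` F. \<phi> (g f) * f) \<in> N"
      using k e by (intro exI[of _ "\<lambda>f. k (app f u)"]) auto
  qed (use N \<phi> F e in auto)
  then show ?thesis by blast
qed

end

section \<open>Lifting of the torsion theories\<close>

locale ring_module = comm_subring G
  for G :: "'u::ring_1 set" +
  fixes act :: "'u \<Rightarrow> 'm::ab_group_add \<Rightarrow> 'm"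
  assumes U_module: "U_module act"
begin

lemma act_add_left: "act (a + b) x = act a x + act b x"
  and act_add: "act a (x + y) = act a x + act a y"
  and act_mult: "act (a * b) x = act a (act b x)"
  and act_one [simp]: "act 1 x = x"
  using U_module by (simp_all add: U_module_def)

lemma act_zero [simp]: "act a 0 = 0" and act_zero_left [simp]: "act 0 x = 0"
  using act_add[of a 0 0] act_add_left[of 0 0 x] by simp_all

definition ann :: "'m \<Rightarrow> 'u set" where
  "ann x = {a \<in> G. act a x = 0}"

definition bounded_supp :: "nat \<Rightarrow> 'm \<Rightarrow> bool" where
  "bounded_supp i x \<longleftrightarrow> (\<forall>P. g_prime G P \<longrightarrow> ann x \<subseteq> P \<longrightarrow> P \<in> Zc G i)"

text \<open>An element survives localization at \<open>P\<close> exactly when its annihilator lies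
  in \<open>P\<close>, so torsion can be tested elementwise.\<close>

lemma in_T_iff: "in_T G act i N \<longleftrightarrow> (\<forall>x\<in>N. bounded_supp i x)"
proof -
  have "(\<forall>s\<in>G - P. act s x \<noteq> 0) \<longleftrightarrow> ann x \<subseteq> P" for x P by (auto simp: ann_def)
  then have "Supp G act N = {P. g_prime G P \<and> (\<exists>x\<in>N. ann x \<subseteq> P)}"
    by (simp add: Supp_def Spec_def)
  then show ?thesis unfolding in_T_def bounded_supp_def by blast
qed

lemma bounded_supp_zero: "bounded_supp i 0"
  by (auto simp: bounded_supp_def ann_def g_prime_def g_ideal_def)

text \<open>If neither annihilator lies in a prime \<open>P\<close>, the product of suitable
  elements outside \<open>P\<close> annihilates both \<open>x\<close> and \<open>y\<close>, hence
  their sum.\<close>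

lemma bounded_supp_add:
  assumes x: "bounded_supp i x" and y: "bounded_supp i y"
  shows "bounded_supp i (x + y)"
proof -
  have "ann x \<subseteq> P \<or> ann y \<subseteq> P" if P: "g_prime G P" "ann (x + y) \<subseteq> P" for P
  proof (rule ccontr)
    assume "\<not> ?thesis"
    then obtain a b where ab: "a \<in> ann x" "a \<notin> P" "b \<in> ann y" "b \<notin> P" by blast
    then have "a \<in> G" "b \<in> G" by (simp_all add: ann_def)
    have "act (a * b) x = act b (act a x)" using comm[of a b] \<open>a \<in> G\<close> \<open>b \<in> G\<close> by (metis act_mult)
    then have "a * b \<in> ann (x + y)"
      using ab by (simp add: ann_def act_add act_mult)
    then show False using prime_mult[OF P(1) \<open>a \<in> G\<close> \<open>b \<in> G\<close>] P ab by auto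
  qed
  then show ?thesis using x y by (simp add: bounded_supp_def) blast
qed

text \<open>\<open>N\<close> links the two annihilators: its contraction along \<open>lmul\<close>
  lies in \<open>ann (act u x)\<close>, while \<open>rmul\<close> sends \<open>ann x\<close> into
  it.\<close>

lemma bounded_supp_act:
  assumes fg: "left_fg G (bimod G u)" "right_fg G (bimod G u)" and x: "bounded_supp i x"
  shows "bounded_supp i (act u x)"
proof -
  let ?E = "bimod_ring G"
  interpret E: comm_subring ?E by (rule comm_subring_bimod_ring)
  text \<open>The largest ideal of \<open>?E\<close> on which evaluation at \<open>u\<close> followed by the action on \<open>x\<close>
    vanishes.\<close>
  define N where "N = {c \<in> ?E. \<forall>d\<in>?E. act (app (d * c) u) x = 0}"
  have N: "g_ideal ?E N"
  proof (rule E.idealI)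
    show "a * c \<in> N" if "a \<in> ?E" "c \<in> N" for a c
    proof -
      note ac = that
      have "act (app (d * (a * c)) u) x = 0" if d: "d \<in> ?E" for d
      proof -
        have "act (app ((d * a) * c) u) x = 0"
          using ac(2) E.mult_mem[OF d ac(1)] unfolding N_def by blast
        then show ?thesis by (simp only: mult.assoc)
      qed
      moreover have "a * c \<in> ?E" using ac by (simp add: N_def)
      ultimately show ?thesis by (simp only: N_def mem_Collect_eq) blast
    qed
  qed (auto simp: N_def app_add act_add_left)
  have annN: "f \<in> N" if "f \<in> ?E" "app f u = 0" for f
    using that by (simp add: N_def)
  obtain FL where FL: "finite FL" "FL \<subseteq> bimod G u"
      "bimod G u = {x. \<exists>c. (\<forall>f\<in>FL. c f \<in> G) \<and> x = (\<Sum>f\<in>FL. c f * f)}"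
    using fg(1) unfolding left_fg_def by blast
  obtain FR where FR: "finite FR" "FR \<subseteq> bimod G u"
      "bimod G u = {x. \<exists>c. (\<forall>f\<in>FR. c f \<in> G) \<and> x = (\<Sum>f\<in>FR. f * c f)}"
    using fg(2) unfolding right_fg_def by blast
  obtain F where L: "finite_mod_extension G ?E lmul N F"
  proof -
    have "\<exists>c. (\<forall>f\<in>FL. c f \<in> G) \<and> x = (\<Sum>f\<in>FL. app (lmul (c f)) f)" if "x \<in> bimod G u" for x
      using that unfolding FL(3) by simp
    then have "\<exists>F. finite_mod_extension G ?E lmul N F"
      using FL(1,2) by (intro finite_mod_extension_bimod_ring[OF N annN]) (auto intro: bimod_ring.lmul)
    then show ?thesis using that by blast
  qed
  obtain F' where R: "finite_mod_extension G ?E rmul N F'"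
  proof -
    have "\<exists>c. (\<forall>f\<in>FR. c f \<in> G) \<and> x = (\<Sum>f\<in>FR. app (rmul (c f)) f)" if "x \<in> bimod G u" for x
      using that unfolding FR(3) by simp
    \<comment> \<open>\<open>rmul\<close> reverses products; commutativity of \<open>G\<close> makes
      it a homomorphism there.\<close>
    moreover have "rmul (a * b) = rmul a * rmul b" if "a \<in> G" "b \<in> G" for a b
      using comm[OF that] by simp
    ultimately have "\<exists>F. finite_mod_extension G ?E rmul N F"
      using FR(1,2) by (intro finite_mod_extension_bimod_ring[OF N annN]) (auto intro: bimod_ring.rmul simp del: rmul_hom(3))
    then show ?thesis using that by blast
  qed
  interpret L: finite_mod_extension G ?E lmul N F by (rule L)
  interpret R: finite_mod_extension G ?E rmul N F' by (rule R)
  have contrN: "L.contr N \<subseteq> ann (act u x)"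
  proof
    fix a assume "a \<in> L.contr N"
    then have a: "a \<in> G" "lmul a \<in> N" by (auto simp: L.contr_def)
    then have "act (app (1 * lmul a) u) x = 0" unfolding N_def using E.one_mem by blast
    then show "a \<in> ann (act u x)" using a by (simp add: ann_def act_mult)
  qed
  \<comment> \<open>Since \<open>d\<close> commutes with \<open>rmul b\<close>, the factor
    \<open>b\<close> reaches \<open>x\<close> first and kills it.\<close>
  have annI: "rmul b \<in> N" if b: "b \<in> ann x" for b
  proof -
    have bG: "b \<in> G" and bx: "act b x = 0" using b by (auto simp: ann_def)
    have rb: "rmul b \<in> ?E" using bG by (rule bimod_ring.rmul)
    have "act (app (d * rmul b) u) x = 0" if d: "d \<in> ?E" for d
    proof -
      have "app (d * rmul b) u = app d u * b" using E.comm[OF d rb] by simp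
      then show ?thesis using bx by (simp add: act_mult)
    qed
    then show ?thesis using rb by (simp add: N_def)
  qed
  show ?thesis
    unfolding bounded_supp_def
  proof (intro allI impI)
    fix P assume P: "g_prime G P" "ann (act u x) \<subseteq> P"
    obtain Q where Q: "g_prime ?E Q" "N \<subseteq> Q" "L.contr Q = P"
      using L.going_up[OF N order_refl P(1)] contrN P(2) by blast
    have "ann x \<subseteq> R.contr Q" using annI Q(2) by (auto simp: R.contr_def ann_def)
    then have "R.contr Q \<in> Zc G i"
      using x R.contr_prime[OF Q(1)] by (simp add: bounded_supp_def)
    then show "P \<in> Zc G i"
      using contr_Zc_transfer[OF L R Q(1,2)] Q(3) by (simp add: L.contr_def R.contr_def)
  qed
qed

lemma ann_act_mono: "a \<in> G \<Longrightarrow> ann x \<subseteq> ann (act a x)"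
proof
  fix b assume "a \<in> G" "b \<in> ann x"
  then have "b \<in> G" "act b x = 0" by (simp_all add: ann_def)
  moreover from this have "act b (act a x) = act a (act b x)"
    using comm[OF \<open>a \<in> G\<close>, of b] by (metis act_mult)
  ultimately show "b \<in> ann (act a x)" by (simp add: ann_def)
qed

text \<open>The elementwise criterion shows that the largest torsion submodule exists, so the
  definite description in \<open>tors\<close> denotes it.\<close>

lemma tors_eq: "tors G act i = {x. bounded_supp i x}"
  unfolding tors_def
proof (rule the_equality)
  have "bounded_supp i (act a x)" if "a \<in> G" "bounded_supp i x" for a x
    using that ann_act_mono[of a x] unfolding bounded_supp_def by blast
  then show "G_submodule G act {x. bounded_supp i x} \<and> in_T G act i {x. bounded_supp i x} \<and>
      (\<forall>N'. G_submodule G act N' \<and> in_T G act i N' \<longrightarrow> N' \<subseteq> {x. bounded_supp i x})"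
    by (auto simp: G_submodule_def in_T_iff bounded_supp_zero bounded_supp_add)
  then show "N = {x. bounded_supp i x}" if "G_submodule G act N \<and> in_T G act i N \<and>
      (\<forall>N'. G_submodule G act N' \<and> in_T G act i N' \<longrightarrow> N' \<subseteq> N)" for N
    using that by blast
qed

lemma tors_mono: "i \<le> j \<Longrightarrow> tors G act i \<subseteq> tors G act j"
  unfolding tors_eq bounded_supp_def using Zc_mono by blast

text \<open>If \<open>ann x\<close> were a prime in an earlier layer, \<open>x\<close> would lie in
  the vanishing smaller torsion part. The case \<open>i = 0\<close> encodes t_{-1}(M) = 0.\<close>

lemma coheight_Ass:
  assumes top: "tors G act i = UNIV" and low: "i = 0 \<or> tors G act (i - 1) = {0}"
    and P: "P \<in> Ass G act"
  shows "coheight G P = i"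
  unfolding coheight_def
proof (rule Least_equality)
  obtain x where x: "P = ann x" and gP: "g_prime G P"
    using P by (auto simp: Ass_def ann_def Spec_def)
  show "P \<in> Zc G i" using top x gP by (auto simp: tors_eq bounded_supp_def)
  show "i \<le> j" if j: "P \<in> Zc G j" for j
  proof (rule ccontr)
    assume "\<not> i \<le> j"
    then have "i \<noteq> 0" "j \<le> i - 1" by auto
    then have "P \<in> Zc G (i - 1)" using Zc_mono j by blast
    then have "bounded_supp (i - 1) x"
      using Zc_upward x unfolding bounded_supp_def by blast
    then have "x = 0" using low \<open>i \<noteq> 0\<close> by (auto simp: tors_eq)
    then have "1 \<in> P" using x by (simp add: ann_def)
    then show False using prime_one gP by blast
  qed
qed

end

section \<open>Finite Krull dimension\<close>

fun mon :: "'a::monoid_mult list \<Rightarrow> nat list \<Rightarrow> 'a" where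
  "mon (y # ys) (a # as) = y ^ a * mon ys as"
| "mon _ _ = 1"

text \<open>Bounding each exponent separately, rather than the total degree, makes the number of
  monomials an exact power.\<close>

definition exps :: "nat \<Rightarrow> nat \<Rightarrow> nat list set" where
  "exps d m = {as. set as \<subseteq> {..d} \<and> length as = m}"

lemma finite_exps: "finite (exps d m)" and card_exps: "card (exps d m) = (d + 1) ^ m"
  unfolding exps_def by (simp_all add: finite_lists_length_eq card_lists_length_eq)

lemma exps_mono: "d \<le> e \<Longrightarrow> exps d m \<subseteq> exps e m"
  by (auto simp: exps_def)

lemma exps_0 [simp]: "exps d 0 = {[]}"
  by (auto simp: exps_def)

lemma Cons_mem_exps [simp]: "a # as \<in> exps d (Suc m) \<longleftrightarrow> a \<le> d \<and> as \<in> exps d m"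
  by (auto simp: exps_def)

lemma exps_Suc_cases:
  assumes "as \<in> exps d (Suc m)"
  obtains b bs where "as = b # bs" "b \<le> d" "bs \<in> exps d m"
  using assms by (cases as) (auto simp: exps_def)

lemma sum_exps_Suc: "(\<Sum>as\<in>exps d (Suc m). f as) = (\<Sum>i\<le>d. \<Sum>as\<in>exps d m. f (i # as))"
proof -
  have "exps d (Suc m) = (\<lambda>(i, as). i # as) ` ({..d} \<times> exps d m)"
    by (auto elim!: exps_Suc_cases)
  moreover have "inj_on (\<lambda>(i, as). i # as) ({..d} \<times> exps d m)"
    by (auto simp: inj_on_def)
  ultimately have "(\<Sum>as\<in>exps d (Suc m). f as) = (\<Sum>(i, as)\<in>{..d} \<times> exps d m. f (i # as))"
    by (simp only: sum.reindex o_def case_prod_unfold)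
  then show ?thesis by (simp only: sum.cartesian_product)
qed

section \<open>Algebraic independence modulo a prime\<close>

locale comm_subalgebra = comm_subring G
  for G :: "'u::ring_1 set" +
  fixes emb :: "'k::field \<Rightarrow> 'u"
  assumes K_algebra: "is_K_algebra emb"
    and emb_mem [simp]: "emb c \<in> G"
begin

lemma emb_one [simp]: "emb 1 = 1" and emb_add: "emb (a + b) = emb a + emb b"
  and emb_mult: "emb (a * b) = emb a * emb b" and emb_comm: "emb c * u = u * emb c"
  using K_algebra unfolding is_K_algebra_def by blast+

lemma emb_zero [simp]: "emb 0 = 0"
  using emb_add[of 0 0] by simp

lemma emb_sum: "emb (sum f I) = (\<Sum>i\<in>I. emb (f i))"
  by (induction I rule: infinite_finite_induct) (auto simp: emb_add)

sublocale vs: vector_space "\<lambda>c u. emb c * u"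
  by standard (simp_all add: algebra_simps emb_add emb_mult)

lemma emb_mem_prime:
  assumes P: "g_prime G P" and "emb c \<in> P"
  shows "c = 0"
proof (rule ccontr)
  assume "c \<noteq> 0"
  then have "1 = emb (inverse c) * emb c" by (simp flip: emb_mult)
  then have "1 \<in> P" using ideal_mult_left[OF prime_ideal[OF P] emb_mem assms(2)] by metis
  then show False using prime_one[OF P] by simp
qed

lemma mon_mem: "set ys \<subseteq> G \<Longrightarrow> mon ys as \<in> G"
  by (induction ys as rule: mon.induct) auto

text \<open>Algebraic independence over K of the residue classes of \<open>ys\<close> in G/P; a
  polynomial is given by its coefficients on a box of exponents.\<close>

definition alg_indep_mod :: "'u set \<Rightarrow> 'u list \<Rightarrow> bool" where
  "alg_indep_mod P ys \<longleftrightarrow> (\<forall>d c. (\<Sum>as\<in>exps d (length ys). emb (c as) * mon ys as) \<in> P \<longrightarrow>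
     (\<forall>as\<in>exps d (length ys). c as = 0))"

lemma alg_indep_modD:
  "alg_indep_mod P ys \<Longrightarrow> (\<Sum>as\<in>exps d (length ys). emb (c as) * mon ys as) \<in> P \<Longrightarrow>
    as \<in> exps d (length ys) \<Longrightarrow> c as = 0"
  unfolding alg_indep_mod_def by blast

lemma alg_indep_mod_Nil: "g_prime G P \<Longrightarrow> alg_indep_mod P []"
  by (auto simp: alg_indep_mod_def intro: emb_mem_prime)

text \<open>Sorted by powers of \<open>y\<close>, a relation has polynomials in \<open>ys\<close> as
  coefficients, and such a coefficient vanishes identically once it lies in \<open>Q\<close>. Then
  \<open>coeffs_mem_prime\<close> puts all of them into \<open>P\<close>, hence into
  \<open>Q\<close>.\<close>

lemma alg_indep_mod_Cons:
  assumes P: "g_prime G P" and Q: "g_prime G Q" and "P \<subseteq> Q" and y: "y \<in> Q" "y \<notin> P"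
    and ys: "set ys \<subseteq> G" "alg_indep_mod Q ys"
  shows "alg_indep_mod P (y # ys)"
  unfolding alg_indep_mod_def
proof (intro allI impI)
  fix d c
  let ?m = "length ys"
  assume rel: "(\<Sum>as\<in>exps d (length (y # ys)). emb (c as) * mon (y # ys) as) \<in> P"
  define b where "b i = (\<Sum>as\<in>exps d ?m. emb (c (i # as)) * mon ys as)" for i
  have yG: "y \<in> G" using y ideal_subset[OF prime_ideal[OF Q]] by auto
  have bG: "b i \<in> G" for i using mon_mem[OF ys(1)] by (auto simp: b_def intro!: sum_mem)
  have zero: "c (i # as) = 0" if "b i \<in> Q" "as \<in> exps d ?m" for i as
    using alg_indep_modD[OF ys(2), where c = "\<lambda>as. c (i # as)"] that
    by (simp add: b_def)
  have "(\<Sum>as\<in>exps d (length (y # ys)). emb (c as) * mon (y # ys) as) =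
      (\<Sum>i\<le>d. \<Sum>as\<in>exps d ?m. emb (c (i # as)) * (y ^ i * mon ys as))"
    by (simp add: sum_exps_Suc)
  also have "\<dots> = (\<Sum>i\<le>d. b i * y ^ i)"
    unfolding b_def sum_distrib_right
    by (intro sum.cong refl) (metis comm mon_mem mult.assoc power_mem yG ys(1))
  finally have rel': "(\<Sum>i\<le>d. b i * y ^ i) \<in> P" using rel by simp
  have "b i \<in> P" if "b i \<in> Q" for i
    using zero[OF that] ideal_zero[OF prime_ideal[OF P]] by (simp add: b_def)
  then have "b i \<in> P" if "i \<le> d" for i
    using coeffs_mem_prime[OF P prime_ideal[OF Q] \<open>P \<subseteq> Q\<close> y bG _ rel' that] by blast
  then show "\<forall>as\<in>exps d (length (y # ys)). c as = 0"
    using zero \<open>P \<subseteq> Q\<close> by (auto elim!: exps_Suc_cases)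
qed

text \<open>A prime outside Z_i starts a strict chain with \<open>i + 1\<close> inclusions, and each
  inclusion contributes one independent element.\<close>

lemma exists_alg_indep_mod:
  assumes "g_prime G P" "P \<notin> Zc G i"
  shows "\<exists>ys. length ys = Suc i \<and> set ys \<subseteq> G \<and> alg_indep_mod P ys"
  using assms
proof (induction i arbitrary: P)
  case 0
  then obtain Q y where Q: "g_prime G Q" "P \<subseteq> Q" "y \<in> Q" "y \<notin> P"
    unfolding Zc_0_iff by blast
  then have "alg_indep_mod P [y]"
    using alg_indep_mod_Cons[OF 0(1) Q] alg_indep_mod_Nil by simp
  then show ?case using Q(3) ideal_subset[OF prime_ideal[OF Q(1)]]
    by (intro exI[of _ "[y]"]) auto
next
  case (Suc i)
  then obtain Q y where Q: "g_prime G Q" "P \<subseteq> Q" "y \<in> Q" "y \<notin> P" "Q \<notin> Zc G i"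
    unfolding Zc_Suc_iff by blast
  then obtain ys where ys: "length ys = Suc i" "set ys \<subseteq> G" "alg_indep_mod Q ys"
    using Suc.IH by blast
  then have "alg_indep_mod P (y # ys)"
    using alg_indep_mod_Cons[OF Suc.prems(1) Q(1-4)] by simp
  then show ?case using ys Q(3) ideal_subset[OF prime_ideal[OF Q(1)]]
    by (intro exI[of _ "y # ys"]) auto
qed

section \<open>The filtration by exponent bounds on monomials in the generators\<close>

lemma mon_mult:
  assumes "set ss \<subseteq> G" "as \<in> exps d (length ss)" "bs \<in> exps e (length ss)"
  shows "\<exists>cs\<in>exps (d + e) (length ss). mon ss as * mon ss bs = mon ss cs"
  using assms
proof (induction ss arbitrary: as bs)
  case Nil
  then show ?case by simp
next
  case (Cons s ss)
  obtain a as' where a: "as = a # as'" "a \<le> d" "as' \<in> exps d (length ss)"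
    using Cons.prems(2) by (auto elim: exps_Suc_cases)
  obtain b bs' where b: "bs = b # bs'" "b \<le> e" "bs' \<in> exps e (length ss)"
    using Cons.prems(3) by (auto elim: exps_Suc_cases)
  obtain cs where cs: "cs \<in> exps (d + e) (length ss)" "mon ss as' * mon ss bs' = mon ss cs"
    using Cons.IH[of as' bs'] Cons.prems(1) a b by auto
  have "mon ss as' * s ^ b = s ^ b * mon ss as'"
    using Cons.prems(1) by (intro comm mon_mem power_mem) auto
  then have "mon (s # ss) as * mon (s # ss) bs = s ^ (a + b) * (mon ss as' * mon ss bs')"
    by (simp add: a b power_add mult.assoc) (simp flip: mult.assoc)
  then show ?case using cs a b by (intro bexI[of _ "(a + b) # cs"]) auto
qed

definition span_mon :: "'u list \<Rightarrow> nat \<Rightarrow> 'u set" where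
  "span_mon ss d = vs.span (mon ss ` exps d (length ss))"

lemma span_mon_mono: "d \<le> e \<Longrightarrow> span_mon ss d \<subseteq> span_mon ss e"
  unfolding span_mon_def by (intro vs.span_mono image_mono exps_mono)

lemma span_mon_mult:
  assumes ss: "set ss \<subseteq> G" and x: "x \<in> span_mon ss d" and y: "y \<in> span_mon ss e"
  shows "x * y \<in> span_mon ss (d + e)"
proof -
  have gen: "mon ss as * y \<in> span_mon ss (d + e)" if as: "as \<in> exps d (length ss)" for as
    using y unfolding span_mon_def
  proof (induction rule: vs.span_induct_alt)
    case base
    then show ?case by (simp add: vs.span_zero)
  next
    case (step c b y)
    then obtain bs where bs: "bs \<in> exps e (length ss)" "b = mon ss bs" by auto
    then have "mon ss as * b \<in> mon ss ` exps (d + e) (length ss)"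
      using mon_mult[OF ss as bs(1)] by auto
    then have "emb c * (mon ss as * b) + mon ss as * y \<in> vs.span (mon ss ` exps (d + e) (length ss))"
      using step(2) vs.span_add[OF vs.span_scale[OF vs.span_base]] by blast
    moreover have "mon ss as * (emb c * b + y) = emb c * (mon ss as * b) + mon ss as * y"
      by (simp only: distrib_left emb_comm[of c] mult.assoc)
    ultimately show ?case by simp
  qed
  show ?thesis
    using x unfolding span_mon_def[of ss d]
  proof (induction rule: vs.span_induct_alt)
    case base
    then show ?case by (simp add: span_mon_def vs.span_zero)
  next
    case (step c a x)
    then have "emb c * (a * y) + x * y \<in> span_mon ss (d + e)"
      using gen vs.span_add[OF vs.span_scale] unfolding span_mon_def by blast
    then show ?case by (simp add: distrib_right mult.assoc)
  qed
qed

lemma one_mem_span_mon: "1 \<in> span_mon ss d"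
proof -
  have "mon ss (replicate (length ss) 0) = 1" by (induction ss) auto
  moreover have "replicate (length ss) 0 \<in> exps d (length ss)" by (auto simp: exps_def)
  ultimately show ?thesis unfolding span_mon_def by (metis imageI vs.span_base)
qed

lemma generator_mem_span_mon:
  assumes "s \<in> set ss"
  shows "s \<in> span_mon ss 1"
proof -
  have "\<exists>as\<in>exps 1 (length ss). mon ss as = s"
    using assms
  proof (induction ss)
    case (Cons t ss)
    show ?case
    proof (cases "s = t")
      case True
      have "mon ss (replicate (length ss) 0) = 1" by (induction ss) auto
      then show ?thesis using True
        by (intro bexI[of _ "1 # replicate (length ss) 0"]) (auto simp: exps_def)
    next
      case False
      then obtain as where "as \<in> exps 1 (length ss)" "mon ss as = s" using Cons by auto
      then show ?thesis by (intro bexI[of _ "0 # as"]) auto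
    qed
  qed simp
  then show ?thesis unfolding span_mon_def by (metis imageI vs.span_base)
qed

lemma span_mon_power: "set ss \<subseteq> G \<Longrightarrow> y \<in> span_mon ss e \<Longrightarrow> y ^ a \<in> span_mon ss (a * e)"
  by (induction a) (auto intro: one_mem_span_mon span_mon_mult)

text \<open>Each of the \<open>length ys\<close> powers lies in level \<open>d * e\<close>, and
  levels add under multiplication. The bound is linear in \<open>d\<close>, as the later dimension
  count requires.\<close>

lemma mon_mem_span_mon:
  assumes ss: "set ss \<subseteq> G" and "set ys \<subseteq> span_mon ss e" "as \<in> exps d (length ys)"
  shows "mon ys as \<in> span_mon ss (length ys * (d * e))"
  using assms(2-)
proof (induction ys arbitrary: as)
  case Nil
  then show ?case by (simp add: one_mem_span_mon)
next
  case (Cons y ys)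
  obtain a as' where a: "as = a # as'" "a \<le> d" "as' \<in> exps d (length ys)"
    using Cons.prems(2) by (auto elim: exps_Suc_cases)
  have "y ^ a \<in> span_mon ss (d * e)"
    using span_mon_power[OF ss, of y e a] Cons.prems(1) span_mon_mono[of "a * e" "d * e" ss] a(2)
    by auto
  then have "y ^ a * mon ys as' \<in> span_mon ss (d * e + length ys * (d * e))"
    using Cons.IH[of as'] Cons.prems(1) a by (intro span_mon_mult[OF ss]) auto
  then show ?case using a by simp
qed

text \<open>The union of the levels is itself a subalgebra containing the generators.\<close>

lemma alg_gen_subset_span_mon:
  assumes "set ss \<subseteq> G"
  shows "alg_gen emb (set ss) \<subseteq> (\<Union>d. span_mon ss d)"
proof -
  have "is_subalg emb (\<Union>d. span_mon ss d)"
    unfolding is_subalg_def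
  proof (intro conjI ballI)
    have "emb c * 1 \<in> span_mon ss 0" for c
      using one_mem_span_mon unfolding span_mon_def by (rule vs.span_scale)
    then show "range emb \<subseteq> (\<Union>d. span_mon ss d)" by auto
    fix x y assume "x \<in> (\<Union>d. span_mon ss d)" "y \<in> (\<Union>d. span_mon ss d)"
    then obtain d e where x: "x \<in> span_mon ss d" and y: "y \<in> span_mon ss e" by blast
    then show "x * y \<in> (\<Union>d. span_mon ss d)" using span_mon_mult[OF assms] by blast
    have "x \<in> span_mon ss (max d e)" "y \<in> span_mon ss (max d e)"
      using x y span_mon_mono[of d "max d e" ss] span_mon_mono[of e "max d e" ss] by auto
    then have "x + y \<in> span_mon ss (max d e)" unfolding span_mon_def by (rule vs.span_add)
    then show "x + y \<in> (\<Union>d. span_mon ss d)" by blast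
    have "- x \<in> span_mon ss d" using x unfolding span_mon_def by (rule vs.span_neg)
    then show "- x \<in> (\<Union>d. span_mon ss d)" by blast
  qed
  moreover have "set ss \<subseteq> (\<Union>d. span_mon ss d)" using generator_mem_span_mon by blast
  ultimately show ?thesis unfolding alg_gen_def by blast
qed

text \<open>There are \<open>(d + 1) ^ (n + 1)\<close> monomials of multidegree at most \<open>d\<close> in \<open>n + 1\<close> elements, but
  they lie in a space whose dimension is bounded by a polynomial of degree \<open>n\<close> in \<open>d\<close>.\<close>

lemma not_alg_indep_mod:
  assumes ss: "set ss \<subseteq> G" "alg_gen emb (set ss) = G"
    and ys: "set ys \<subseteq> G" "length ys = Suc (length ss)" and P: "g_prime G P"
  shows "\<not> alg_indep_mod P ys"
proof
  assume indep: "alg_indep_mod P ys"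
  define n where "n = length ss"
  have "\<exists>e. set ys \<subseteq> span_mon ss e"
    using ys(1)
  proof (induction ys)
    case (Cons y ys)
    then obtain e where e: "set ys \<subseteq> span_mon ss e" by auto
    obtain d where d: "y \<in> span_mon ss d"
      using Cons.prems alg_gen_subset_span_mon[OF ss(1)] ss(2) by auto
    have "set (y # ys) \<subseteq> span_mon ss (max d e)"
      using d e span_mon_mono[of d "max d e" ss] span_mon_mono[of e "max d e" ss] by auto
    then show ?case by blast
  qed simp
  then obtain e where e: "set ys \<subseteq> span_mon ss e" by blast
  \<comment> \<open>\<open>D\<close> is the level holding the monomials in \<open>ys\<close> with
    exponents up to \<open>d\<close>. The choice \<open>d = C ^ n\<close> absorbs the constant:
    (D+1)^n \<le> C^n (d+1)^n = d (d+1)^n < (d+1)^(n+1).\<close>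
  define C where "C = Suc n * e + 1"
  define d where "d = C ^ n"
  define D where "D = Suc n * (d * e)"
  define F where "F = mon ss ` exps D n"
  have "finite F" by (simp add: F_def finite_exps)
  have "D + 1 \<le> C * (d + 1)" by (simp add: D_def C_def algebra_simps)
  then have "(D + 1) ^ n \<le> (C * (d + 1)) ^ n" by (rule power_mono) simp
  also have "\<dots> = d * (d + 1) ^ n" by (simp only: d_def power_mult_distrib)
  also have "\<dots> < (d + 1) ^ Suc n" by simp
  finally have "card F < card (exps d (Suc n))"
    using card_image_le[OF finite_exps, of "mon ss" D n] by (simp add: F_def card_exps)
  have "\<exists>g. mon ys as = (\<Sum>f\<in>F. emb (g f) * f)" if "as \<in> exps d (Suc n)" for as
  proof -
    have "mon ys as \<in> span_mon ss D"
      using mon_mem_span_mon[OF ss(1) e, of as d] that ys(2) by (simp add: D_def n_def)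
    then show ?thesis
      using vs.span_finite[OF \<open>finite F\<close>] by (auto simp: span_mon_def F_def n_def)
  qed
  then obtain g where g: "\<And>as. as \<in> exps d (Suc n) \<Longrightarrow> mon ys as = (\<Sum>f\<in>F. emb (g as f) * f)"
    by metis
  \<comment> \<open>Elimination is applied to the field K with the prime \<open>{0}\<close>, where
    membership in the prime means vanishing.\<close>
  interpret K: comm_subring "UNIV :: 'k set" by standard (auto simp: mult.commute)
  have "(1 :: 'k) \<notin> {0}" by simp
  then have "{0 :: 'k} \<noteq> UNIV" by blast
  then have "g_prime (UNIV :: 'k set) {0}" by (auto simp: g_prime_def g_ideal_def)
  from K.linear_system_nontrivial_solution[OF this \<open>finite F\<close> finite_exps \<open>card F < _\<close> UNIV_I, of g]
  obtain a where a: "\<exists>as\<in>exps d (Suc n). a as \<noteq> 0"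
      "\<forall>f\<in>F. (\<Sum>as\<in>exps d (Suc n). a as * g as f) = 0" unfolding singleton_iff by blast
  have "(\<Sum>as\<in>exps d (Suc n). emb (a as) * mon ys as) =
      (\<Sum>as\<in>exps d (Suc n). \<Sum>f\<in>F. emb (a as * g as f) * f)"
    by (rule sum.cong) (simp_all only: g sum_distrib_left emb_mult mult.assoc)
  also have "\<dots> = (\<Sum>f\<in>F. emb (\<Sum>as\<in>exps d (Suc n). a as * g as f) * f)"
    by (subst sum.swap) (simp add: emb_sum sum_distrib_right)
  also have "\<dots> = 0" using a(2) by simp
  finally have "(\<Sum>as\<in>exps d (length ys). emb (a as) * mon ys as) \<in> P"
    using ideal_zero[OF prime_ideal[OF P]] ys(2) by (simp add: n_def)
  then have "a as = 0" if "as \<in> exps d (length ys)" for as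
    using alg_indep_modD[OF indep] that by blast
  then show False using a(1) ys(2) by (simp add: n_def)
qed

text \<open>A prime outside this layer would yield one more independent element than there are
  generators. So the number of generators bounds every coheight.\<close>

lemma Spec_eq_Zc:
  assumes "set ss \<subseteq> G" "alg_gen emb (set ss) = G" and "g_prime G P"
  shows "P \<in> Zc G (length ss)"
  using exists_alg_indep_mod[OF assms(3)] not_alg_indep_mod[OF assms(1,2) _ _ assms(3)] by blast

end

section \<open>Lifting and the torsion level of a simple module\<close>

theorem theorem3p3:
  fixes emb :: "'k::{alg_closed_field, field_char_0} \<Rightarrow> 'u::ring_1"
    and G :: "'u set"
    and act :: "'u \<Rightarrow> 'm::ab_group_add \<Rightarrow> 'm"
  assumes hyps: "standing_hyps emb G"
    and modM: "U_module act"
  shows "(\<forall>i. U_submodule act (tors G act i))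
         \<and> (simple_U_module act \<longrightarrow>
              (\<exists>!i. tors G act i = UNIV \<and> (i = 0 \<or> tors G act (i - 1) = {0}))
              \<and> (\<forall>i. tors G act i = UNIV \<and> (i = 0 \<or> tors G act (i - 1) = {0})
                     \<longrightarrow> (\<forall>P\<in>Ass G act. coheight G P = i)))"
proof -
  have alg: "is_K_algebra emb" and sub: "is_subalg emb G"
    and comm: "\<forall>a\<in>G. \<forall>b\<in>G. a * b = b * a" and fg: "\<And>u. left_fg G (bimod G u)" "\<And>u. right_fg G (bimod G u)"
    using hyps by (simp_all add: standing_hyps_def)
  obtain S where "finite S" "S \<subseteq> G" "alg_gen emb S = G"
    using hyps unfolding standing_hyps_def by blast
  moreover obtain ss where "set ss = S" using \<open>finite S\<close> finite_list by blast
  ultimately have ss: "set ss \<subseteq> G" "alg_gen emb (set ss) = G" by simp_all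
  have emb: "emb c \<in> G" for c using sub by (auto simp: is_subalg_def)
  have "emb 1 = 1" using alg by (simp add: is_K_algebra_def)
  then have "1 \<in> G" using emb by metis
  then interpret comm_subalgebra G emb
    using alg sub comm emb by unfold_locales (auto simp: is_subalg_def)
  interpret ring_module G act
    using modM by unfold_locales
  have lift: "U_submodule act (tors G act i)" for i
    by (auto simp: U_submodule_def tors_eq bounded_supp_zero bounded_supp_add bounded_supp_act fg)
  define i where "i = (LEAST i. tors G act i = UNIV)"
  \<comment> \<open>All primes lie in this layer, so every element is torsion and the least index
    exists.\<close>
  have "tors G act (length ss) = UNIV"
    using Spec_eq_Zc[OF ss] by (auto simp: tors_eq bounded_supp_def)
  then have i: "tors G act i = UNIV" unfolding i_def by (rule LeastI)
  have least: "j < i \<Longrightarrow> tors G act j \<noteq> UNIV" for j unfolding i_def by (rule not_less_Least)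
  have unique: "\<exists>!i. tors G act i = UNIV \<and> (i = 0 \<or> tors G act (i - 1) = {0})"
    if simple: "simple_U_module act"
  proof (rule ex1I[of _ i])
    have nontriv: "(UNIV :: 'm set) \<noteq> {0}"
      and dich: "tors G act j = {0} \<or> tors G act j = UNIV" for j
      using simple lift[of j] by (auto simp: simple_U_module_def)
    show "tors G act i = UNIV \<and> (i = 0 \<or> tors G act (i - 1) = {0})"
      \<comment> \<open>For positive \<open>i\<close>, minimality rules out the whole module at
        \<open>i - 1\<close>, leaving zero.\<close>
      using i dich[of "i - 1"] least[of "i - 1"] by auto
    fix j assume j: "tors G act j = UNIV \<and> (j = 0 \<or> tors G act (j - 1) = {0})"
    show "j = i"
    proof (rule ccontr)
      assume "j \<noteq> i"
      \<comment> \<open>Minimality excludes \<open>j < i\<close>; then t_i lies in t_{j-1} = 0,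
        although t_i is the whole nonzero module.\<close>
      then have "i < j" using least[of j] j by force
      then have "tors G act i \<subseteq> {0}" using tors_mono[of i "j - 1"] j by auto
      then show False using i nontriv by auto
    qed
  qed
  show ?thesis
  proof (intro conjI allI impI ballI)
    show "coheight G P = j"
      if "tors G act j = UNIV \<and> (j = 0 \<or> tors G act (j - 1) = {0})" "P \<in> Ass G act" for j P
      by (rule coheight_Ass[OF conjunct1[OF that(1)] conjunct2[OF that(1)] that(2)])
  qed (rule lift, erule unique)
qed

end
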